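(* Let $(X,\mathcal B,\mu)$ be a standard probability space and let $T:X\to X$ be a measurable, almost surely one-to-one, $\mu$-preserving, ergodic and aperiodic transformation. Fix a natural number $l\ge 2$. Then in the space $\mathfrak P_l$ of all $l$-element measurable partitions of $X$, endowed with the Rokhlin metric, there exists a residual subset $\mathfrak C$ such that for every $\mathcal P\in\mathfrak C$ the generated process $(\{1,\dots,l\}^{\mathbb Z},\mathcal C,\nu_{\mathcal P},\sigma)$ has the following property: there exists a set $\mathbb N_0\subset\mathbb N$ of upper density one such that for every $\epsilon>0$ there is $n_\epsilon\in\mathbb N$ such that for every $n\in\mathbb N_0$ with $n>n_\epsilon$ and every block $B\in\{1,\dots,l\}^n$ of length $n$ with $\nu_{\mathcal P}([B])>0$, $$F_B(\epsilon)<\epsilon^2,$$ where $F_B$ is the distribution function of the normalised entry time to the cylinder $[B]$.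
   Context: Aperiodic means that the set of periodic points of $T$ has $\mu$-measure zero. $\mathfrak P_l$ is the collection of all measurable partitions of $X$ into $l$ cells (identified modulo $\mu$-null sets, null cells allowed). The Rokhlin metric on $\mathfrak P_l$, which makes it a complete metric space, is $$d(\mathcal P,\mathcal Q)=\inf_\pi\sum_{A\in\mathcal P}\mu(A\,\triangle\,\pi(A)),$$ where $\pi$ ranges over all bijections from $\mathcal P$ to $\mathcal Q$ and $\triangle$ is the symmetric difference. A subset of a complete metric space is residual if it contains a dense $G_\delta$ set. Generated process: given $\mathcal P=\{P_1,\dots,P_l\}$ (with any enumeration of its cells), let $c(x)=i$ if $x\in P_i$, and $\pi_{\mathcal P}(x)=(c(T^kx))_{k\in\mathbb Z}\in\{1,\dots,l\}^{\mathbb Z}$ (defined for $\mu$-almost every $x$). Then $\nu_{\mathcal P}$ is the image of $\mu$ under $\pi_{\mathcal P}$, $\mathcal C$ is the product $\sigma$-algebra, and $\sigma$ is the left shift. A block of length $n$ is a word $B=(B_0,\dots,B_{n-1})\in\{1,\dots,l\}^n$; it is identified with the cylinder $[B]=\{y\in\{1,\dots,l\}^{\mathbb Z}:(y_0,\dots,y_{n-1})=B\}$. For a block $B$ with $\nu_{\mathcal P}([B])>0$, set $\tau_B(y)=\min\{k\ge1:\sigma^ky\in[B]\}$, which is $\nu_{\mathcal P}$-almost surely finite. The normalised entry time to $B$ is the random variable $\nu_{\mathcal P}([B])\,\tau_B$ on the whole probability space $(\{1,\dots,l\}^{\mathbb Z},\nu_{\mathcal P})$ (not conditioned on $[B]$),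 and its distribution function is $$F_B(t)=\nu_{\mathcal P}\big(\{y:\nu_{\mathcal P}([B])\,\tau_B(y)\le t\}\big),\qquad t\ge0.$$ The upper density of $\mathbb N_0\subset\mathbb N$ is $\overline D(\mathbb N_0)=\limsup_{n\to\infty}\frac{\#(\mathbb N_0\cap[1,n])}{n}$. *)

theory Defs
  imports "HOL-Probability.Probability" "HOL-Combinatorics.Permutations"
begin

definition isomorphic_mod0 :: "'a measure \<Rightarrow> 'b measure \<Rightarrow> bool" where
  "isomorphic_mod0 M N \<longleftrightarrow>
    (\<exists>A f B. A \<in> sets M \<and> space M - A \<in> null_sets M \<and>
             B \<in> sets N \<and> space N - B \<in> null_sets N \<and>
             bij_betw f A B \<and>
             f \<in> measurable (restrict_space M A) (restrict_space N B) \<and>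
             inv_into A f \<in> measurable (restrict_space N B) (restrict_space M A) \<and>
             (\<forall>C\<in>sets N. C \<subseteq> B \<longrightarrow> emeasure M (f -` C \<inter> A) = emeasure N C))"

text \<open>
  Every standard Borel space is Borel isomorphic to a Borel subset of the real line, so the
  models may be taken to be the Borel probability measures on the line (atoms included).
  Passing to completions covers both conventions in use: standard Borel spaces with a Borel
  probability measure, and complete Lebesgue-Rokhlin spaces.
\<close>

definition standard_prob_space :: "'a measure \<Rightarrow> bool" where
  "standard_prob_space M \<longleftrightarrow>
    prob_space M \<and>
    (\<exists>N :: real measure. prob_space N \<and> sets N = sets borel \<and>
       isomorphic_mod0 (completion M) (completion N))"

definition ae_injective :: "'a measure \<Rightarrow> ('a \<Rightarrow> 'a) \<Rightarrow> bool" where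
  "ae_injective M T \<longleftrightarrow> (\<exists>N\<in>null_sets M. inj_on T (space M - N))"

definition measure_preserving_map :: "'a measure \<Rightarrow> ('a \<Rightarrow> 'a) \<Rightarrow> bool" where
  "measure_preserving_map M T \<longleftrightarrow> T \<in> measurable M M \<and> distr M M T = M"

definition ergodic_map :: "'a measure \<Rightarrow> ('a \<Rightarrow> 'a) \<Rightarrow> bool" where
  "ergodic_map M T \<longleftrightarrow>
    (\<forall>A\<in>sets M. T -` A \<inter> space M = A \<longrightarrow> measure M A = 0 \<or> measure M A = 1)"

definition aperiodic_map :: "'a measure \<Rightarrow> ('a \<Rightarrow> 'a) \<Rightarrow> bool" where
  "aperiodic_map M T \<longleftrightarrow> (AE x in M. \<forall>n\<ge>1. (T ^^ n) x \<noteq> x)"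

text \<open>
  A partition is first given with an enumeration of its cells by \<open>{1..l}\<close>. Points of the
  partition space are classes of enumerated partitions that agree up to a renumbering of the
  cells and null sets; values of \<open>P\<close> outside \<open>{1..l}\<close> are thereby ignored.
\<close>

definition enum_partitions :: "'a measure \<Rightarrow> nat \<Rightarrow> (nat \<Rightarrow> 'a set) set" where
  "enum_partitions M l =
    {P. (\<forall>i\<in>{1..l}. P i \<in> sets M) \<and> disjoint_family_on P {1..l} \<and> (\<Union>i\<in>{1..l}. P i) = space M}"

definition same_partition :: "'a measure \<Rightarrow> nat \<Rightarrow> ((nat \<Rightarrow> 'a set) \<times> (nat \<Rightarrow> 'a set)) set" where
  "same_partition M l =
    {(P, Q). P \<in> enum_partitions M l \<and> Q \<in> enum_partitions M l \<and>
       (\<exists>\<pi>. \<pi> permutes {1..l} \<and> (\<forall>i\<in>{1..l}. sym_diff (P i) (Q (\<pi> i)) \<in> null_sets M))}"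

definition partition_space :: "'a measure \<Rightarrow> nat \<Rightarrow> (nat \<Rightarrow> 'a set) set set" where
  "partition_space M l = enum_partitions M l // same_partition M l"

definition enum_dist :: "'a measure \<Rightarrow> nat \<Rightarrow> (nat \<Rightarrow> 'a set) \<Rightarrow> (nat \<Rightarrow> 'a set) \<Rightarrow> real" where
  "enum_dist M l P Q =
    (INF \<pi>\<in>{\<pi>. \<pi> permutes {1..l}}. \<Sum>i\<in>{1..l}. measure M (sym_diff (P i) (Q (\<pi> i))))"

text \<open>The choice of representatives is immaterial, see \<open>rokhlin_dist_eq\<close> below.\<close>

definition rokhlin_dist ::
    "'a measure \<Rightarrow> nat \<Rightarrow> (nat \<Rightarrow> 'a set) set \<Rightarrow> (nat \<Rightarrow> 'a set) set \<Rightarrow> real" where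
  "rokhlin_dist M l p q = enum_dist M l (SOME P. P \<in> p) (SOME Q. Q \<in> q)"

definition rokhlin_topology :: "'a measure \<Rightarrow> nat \<Rightarrow> (nat \<Rightarrow> 'a set) set topology" where
  "rokhlin_topology M l = Metric_space.mtopology (partition_space M l) (rokhlin_dist M l)"

definition residual_in :: "'a topology \<Rightarrow> 'a set \<Rightarrow> bool" where
  "residual_in X C \<longleftrightarrow>
    C \<subseteq> topspace X \<and> (\<exists>G\<subseteq>C. gdelta_in X G \<and> X closure_of G = topspace X)"

text \<open>
  An everywhere defined map of the space into itself that inverts \<open>T\<close> almost surely; it is
  unique up to null sets, and exists by \<open>ae_inverse\<close> below.
\<close>

definition ae_inverse :: "'a measure \<Rightarrow> ('a \<Rightarrow> 'a) \<Rightarrow> 'a \<Rightarrow> 'a" where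
  "ae_inverse M T = (SOME S. S \<in> space M \<rightarrow> space M \<and> (AE x in M. S (T x) = x))"

definition int_iterate :: "'a measure \<Rightarrow> ('a \<Rightarrow> 'a) \<Rightarrow> int \<Rightarrow> 'a \<Rightarrow> 'a" where
  "int_iterate M T k x =
    (if 0 \<le> k then (T ^^ nat k) x else (ae_inverse M T ^^ nat (- k)) x)"

definition cell_index :: "nat \<Rightarrow> (nat \<Rightarrow> 'a set) \<Rightarrow> 'a \<Rightarrow> nat" where
  "cell_index l P x = (THE i. i \<in> {1..l} \<and> x \<in> P i)"

definition itinerary ::
    "'a measure \<Rightarrow> ('a \<Rightarrow> 'a) \<Rightarrow> nat \<Rightarrow> (nat \<Rightarrow> 'a set) \<Rightarrow> 'a \<Rightarrow> int \<Rightarrow> nat" where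
  "itinerary M T l P x = (\<lambda>k. cell_index l P (int_iterate M T k x))"

definition sequence_space :: "nat \<Rightarrow> (int \<Rightarrow> nat) measure" where
  "sequence_space l = PiM UNIV (\<lambda>_. count_space {1..l})"

text \<open>
  The almost sure inverse is only measurable modulo null sets, hence the completion.
\<close>

definition process_measure ::
    "'a measure \<Rightarrow> ('a \<Rightarrow> 'a) \<Rightarrow> nat \<Rightarrow> (nat \<Rightarrow> 'a set) \<Rightarrow> (int \<Rightarrow> nat) measure" where
  "process_measure M T l P = distr (completion M) (sequence_space l) (itinerary M T l P)"

definition left_shift :: "(int \<Rightarrow> 'b) \<Rightarrow> int \<Rightarrow> 'b" where
  "left_shift y = (\<lambda>k. y (k + 1))"

definition blocks :: "nat \<Rightarrow> nat \<Rightarrow> nat list set" where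
  "blocks l n = {B. length B = n \<and> set B \<subseteq> {1..l}}"

definition cylinder :: "nat \<Rightarrow> nat list \<Rightarrow> (int \<Rightarrow> nat) set" where
  "cylinder l B = {y \<in> space (sequence_space l). \<forall>j<length B. y (int j) = B ! j}"

definition entry_time :: "nat \<Rightarrow> nat list \<Rightarrow> (int \<Rightarrow> nat) \<Rightarrow> enat" where
  "entry_time l B y = (INF k\<in>{k. 1 \<le> k \<and> (left_shift ^^ k) y \<in> cylinder l B}. enat k)"

definition entry_cdf :: "(int \<Rightarrow> nat) measure \<Rightarrow> nat \<Rightarrow> nat list \<Rightarrow> real \<Rightarrow> real" where
  "entry_cdf \<nu> l B t =
    measure \<nu> {y \<in> space \<nu>.
      ereal (measure \<nu> (cylinder l B)) * ereal_of_enat (entry_time l B y) \<le> ereal t}"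

definition upper_density :: "nat set \<Rightarrow> ereal" where
  "upper_density N = limsup (\<lambda>n. ereal (real (card (N \<inter> {1..n})) / real n))"

lemma ae_inverse:
  assumes "prob_space M" "ae_injective M T"
  shows "ae_inverse M T \<in> space M \<rightarrow> space M" "AE x in M. ae_inverse M T (T x) = x"
proof -
  interpret prob_space M by fact
  obtain N where N: "N \<in> null_sets M" "inj_on T (space M - N)"
    using assms(2) by (auto simp: ae_injective_def)
  obtain a where a: "a \<in> space M"
    using not_empty by blast
  define S where
    "S y = (if y \<in> T ` (space M - N) then inv_into (space M - N) T y else a)" for y
  have "S y \<in> space M" for y
    using a inv_into_into[of y T "space M - N"] by (auto simp: S_def)
  moreover have "S (T x) = x" if "x \<in> space M - N" for x
    using that N(2) by (simp add: S_def)
  then have "AE x in M. S (T x) = x"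
    by (intro AE_I'[OF N(1)]) auto
  ultimately have "\<exists>S. S \<in> space M \<rightarrow> space M \<and> (AE x in M. S (T x) = x)"
    by blast
  from someI_ex[OF this]
  show "ae_inverse M T \<in> space M \<rightarrow> space M" "AE x in M. ae_inverse M T (T x) = x"
    by (auto simp: ae_inverse_def)
qed

lemma cell_index:
  assumes "P \<in> enum_partitions M l" "x \<in> space M"
  shows "cell_index l P x \<in> {1..l}" "x \<in> P (cell_index l P x)"
proof -
  have "(\<Union>i\<in>{1..l}. P i) = space M" and disj: "disjoint_family_on P {1..l}"
    using assms(1) by (auto simp: enum_partitions_def)
  then obtain i where i: "i \<in> {1..l}" "x \<in> P i"
    using assms(2) by blast
  have "cell_index l P x = i"
    unfolding cell_index_def
  proof (rule the_equality)
    show "i \<in> {1..l} \<and> x \<in> P i" using i by blast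
    show "j = i" if "j \<in> {1..l} \<and> x \<in> P j" for j
      using disjoint_family_onD[OF disj, of j i] that i by blast
  qed
  then show "cell_index l P x \<in> {1..l}" "x \<in> P (cell_index l P x)"
    using i by simp_all
qed

lemma enum_dist_attained:
  obtains \<pi> where "\<pi> permutes {1..l}"
    "enum_dist M l P Q = (\<Sum>i\<in>{1..l}. measure M (sym_diff (P i) (Q (\<pi> i))))"
proof -
  let ?f = "\<lambda>\<pi>. \<Sum>i\<in>{1..l}. measure M (sym_diff (P i) (Q (\<pi> i)))"
  have fin: "finite {\<pi>. \<pi> permutes {1..l}}" by (simp add: finite_permutations)
  have ne: "{\<pi>. \<pi> permutes {1..l}} \<noteq> {}" using permutes_id by blast
  have "enum_dist M l P Q = Min (?f ` {\<pi>. \<pi> permutes {1..l}})"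
    unfolding enum_dist_def by (rule cInf_eq_Min) (use fin ne in auto)
  also have "\<dots> \<in> ?f ` {\<pi>. \<pi> permutes {1..l}}"
    by (rule Min_in) (use fin ne in auto)
  finally show ?thesis using that by auto
qed

lemma enum_dist_le:
  assumes "\<pi> permutes {1..l}"
  shows "enum_dist M l P Q \<le> (\<Sum>i\<in>{1..l}. measure M (sym_diff (P i) (Q (\<pi> i))))"
  unfolding enum_dist_def
  by (rule cINF_lower) (use assms in \<open>auto intro!: bdd_belowI[where m=0] sum_nonneg\<close>)

lemma enum_dist_nonneg: "0 \<le> enum_dist M l P Q"
  by (rule enum_dist_attained[of l M P Q]) (simp add: sum_nonneg)

lemma enum_dist_commute_le: "enum_dist M l Q P \<le> enum_dist M l P Q"
proof -
  obtain \<pi> where \<pi>: "\<pi> permutes {1..l}"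
    "enum_dist M l P Q = (\<Sum>i\<in>{1..l}. measure M (sym_diff (P i) (Q (\<pi> i))))"
    by (rule enum_dist_attained)
  have "enum_dist M l Q P \<le> (\<Sum>i\<in>{1..l}. measure M (sym_diff (Q i) (P (inv \<pi> i))))"
    by (rule enum_dist_le) (rule permutes_inv[OF \<pi>(1)])
  also have "\<dots> = (\<Sum>i\<in>{1..l}. measure M (sym_diff (Q (\<pi> i)) (P (inv \<pi> (\<pi> i)))))"
    by (rule sum.permute[OF \<pi>(1), unfolded comp_def])
  also have "\<dots> = enum_dist M l P Q"
    unfolding \<pi>(2) by (simp add: permutes_inverses(2)[OF \<pi>(1)] Un_commute)
  finally show ?thesis .
qed

lemma enum_dist_commute: "enum_dist M l P Q = enum_dist M l Q P"
  by (intro antisym enum_dist_commute_le)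

lemma enum_dist_triangle:
  assumes "prob_space M"
    and P: "P \<in> enum_partitions M l" and Q: "Q \<in> enum_partitions M l"
    and R: "R \<in> enum_partitions M l"
  shows "enum_dist M l P R \<le> enum_dist M l P Q + enum_dist M l Q R"
proof -
  interpret prob_space M by fact
  obtain \<pi> where \<pi>: "\<pi> permutes {1..l}"
    "enum_dist M l P Q = (\<Sum>i\<in>{1..l}. measure M (sym_diff (P i) (Q (\<pi> i))))"
    by (rule enum_dist_attained)
  obtain \<rho> where \<rho>: "\<rho> permutes {1..l}"
    "enum_dist M l Q R = (\<Sum>i\<in>{1..l}. measure M (sym_diff (Q i) (R (\<rho> i))))"
    by (rule enum_dist_attained)
  have ms: "P i \<in> sets M" "Q i \<in> sets M" "R i \<in> sets M" if "i \<in> {1..l}" for i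
    using that P Q R by (auto simp: enum_partitions_def)
  have "enum_dist M l P R \<le> (\<Sum>i\<in>{1..l}. measure M (sym_diff (P i) (R (\<rho> (\<pi> i)))))"
    using enum_dist_le[OF permutes_compose[OF \<pi>(1) \<rho>(1)]] by simp
  also have "\<dots> \<le> (\<Sum>i\<in>{1..l}. measure M (sym_diff (P i) (Q (\<pi> i)))
                   + measure M (sym_diff (Q (\<pi> i)) (R (\<rho> (\<pi> i)))))"
  proof (rule sum_mono)
    fix i assume i: "i \<in> {1..l}"
    have i': "\<pi> i \<in> {1..l}" "\<rho> (\<pi> i) \<in> {1..l}"
      using permutes_in_image[OF \<pi>(1)] permutes_in_image[OF \<rho>(1)] i by blast+
    have "measure M (sym_diff (P i) (R (\<rho> (\<pi> i))))
        \<le> measure M (sym_diff (P i) (Q (\<pi> i)) \<union> sym_diff (Q (\<pi> i)) (R (\<rho> (\<pi> i))))"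
      by (rule finite_measure_mono, blast) (intro sets.Un sets.Diff ms i i')
    also have "\<dots> \<le> measure M (sym_diff (P i) (Q (\<pi> i)))
                   + measure M (sym_diff (Q (\<pi> i)) (R (\<rho> (\<pi> i))))"
      by (rule measure_Un_le) (intro sets.Un sets.Diff ms i i')+
    finally show "measure M (sym_diff (P i) (R (\<rho> (\<pi> i)))) \<le> \<dots>" .
  qed
  also have "\<dots> = enum_dist M l P Q
      + (\<Sum>i\<in>{1..l}. measure M (sym_diff (Q (\<pi> i)) (R (\<rho> (\<pi> i)))))"
    by (simp add: sum.distrib \<pi>(2))
  also have "(\<Sum>i\<in>{1..l}. measure M (sym_diff (Q (\<pi> i)) (R (\<rho> (\<pi> i))))) = enum_dist M l Q R"
    unfolding \<rho>(2) by (rule sum.permute[OF \<pi>(1), unfolded comp_def, symmetric])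
  finally show ?thesis .
qed

lemma enum_dist_eq_0_iff:
  assumes "prob_space M" and P: "P \<in> enum_partitions M l" and Q: "Q \<in> enum_partitions M l"
  shows "enum_dist M l P Q = 0 \<longleftrightarrow> (P, Q) \<in> same_partition M l"
proof -
  interpret prob_space M by fact
  have ms: "sym_diff (P i) (Q (\<pi> i)) \<in> sets M" if "i \<in> {1..l}" "\<pi> permutes {1..l}" for i \<pi>
  proof -
    have "\<pi> i \<in> {1..l}" using that(1) permutes_in_image[OF that(2)] by blast
    then have "P i \<in> sets M" "Q (\<pi> i) \<in> sets M"
      using that(1) P Q unfolding enum_partitions_def by blast+
    then show ?thesis by (intro sets.Un sets.Diff)
  qed
  have null: "sym_diff (P i) (Q (\<pi> i)) \<in> null_sets M \<longleftrightarrow> measure M (sym_diff (P i) (Q (\<pi> i))) = 0"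
    if "i \<in> {1..l}" "\<pi> permutes {1..l}" for i \<pi>
    using ms[OF that] by (simp add: null_sets_def emeasure_eq_measure)
  show ?thesis
  proof
    assume 0: "enum_dist M l P Q = 0"
    obtain \<pi> where \<pi>: "\<pi> permutes {1..l}"
      "enum_dist M l P Q = (\<Sum>i\<in>{1..l}. measure M (sym_diff (P i) (Q (\<pi> i))))"
      by (rule enum_dist_attained)
    have "\<forall>i\<in>{1..l}. measure M (sym_diff (P i) (Q (\<pi> i))) = 0"
      using 0 unfolding \<pi>(2) by (subst (asm) sum_nonneg_eq_0_iff) auto
    then show "(P, Q) \<in> same_partition M l"
      unfolding same_partition_def using \<pi>(1) P Q null by blast
  next
    assume "(P, Q) \<in> same_partition M l"
    then obtain \<pi> where \<pi>: "\<pi> permutes {1..l}"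
      "\<forall>i\<in>{1..l}. sym_diff (P i) (Q (\<pi> i)) \<in> null_sets M"
      by (auto simp: same_partition_def)
    have "(\<Sum>i\<in>{1..l}. measure M (sym_diff (P i) (Q (\<pi> i)))) = 0"
      by (intro sum.neutral ballI) (use \<pi> null in blast)
    then show "enum_dist M l P Q = 0"
      using enum_dist_le[OF \<pi>(1), of M P Q] enum_dist_nonneg[of M l P Q] by linarith
  qed
qed

lemma equiv_same_partition:
  assumes "prob_space M"
  shows "equiv (enum_partitions M l) (same_partition M l)"
proof -
  note zero = enum_dist_eq_0_iff[OF assms]
  have sub: "P \<in> enum_partitions M l \<and> Q \<in> enum_partitions M l"
    if "(P, Q) \<in> same_partition M l" for P Q
    using that by (auto simp: same_partition_def)
  show ?thesis
  proof (rule equivI)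
    show "same_partition M l \<subseteq> enum_partitions M l \<times> enum_partitions M l"
      by (auto simp: same_partition_def)
    show "refl_on (enum_partitions M l) (same_partition M l)"
    proof (rule refl_onI)
      fix P assume "P \<in> enum_partitions M l"
      then show "(P, P) \<in> same_partition M l"
        unfolding same_partition_def using permutes_id[of "{1..l}"] by (auto intro!: exI[of _ id])
    qed
    show "sym (same_partition M l)"
      by (rule symI) (metis zero sub enum_dist_commute)
    show "trans (same_partition M l)"
    proof (rule transI)
      fix P Q R assume a: "(P, Q) \<in> same_partition M l" "(Q, R) \<in> same_partition M l"
      then have "enum_dist M l P Q = 0" "enum_dist M l Q R = 0"
        using zero sub by blast+
      then have "enum_dist M l P R = 0"
        using enum_dist_triangle[OF assms, of P l Q R] enum_dist_nonneg[of M l P R]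
          sub[OF a(1)] sub[OF a(2)] by simp
      then show "(P, R) \<in> same_partition M l"
        using zero sub a by blast
    qed
  qed
qed

lemma rokhlin_dist_eq:
  assumes "prob_space M" and p: "p \<in> partition_space M l" "P \<in> p"
    and q: "q \<in> partition_space M l" "Q \<in> q"
  shows "rokhlin_dist M l p q = enum_dist M l P Q"
proof -
  note eq = equiv_same_partition[OF assms(1), of l]
  have mem: "(A, B) \<in> same_partition M l"
    if "r \<in> partition_space M l" "A \<in> r" "B \<in> r" for r A B
    using that quotient_eq_iff[OF eq] by (auto simp: partition_space_def)
  have sub: "A \<in> enum_partitions M l \<and> B \<in> enum_partitions M l"
    if "(A, B) \<in> same_partition M l" for A B
    using that by (auto simp: same_partition_def)
  let ?P = "SOME P. P \<in> p" and ?Q = "SOME Q. Q \<in> q"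
  have "?P \<in> p" by (rule someI[of "\<lambda>P. P \<in> p", OF p(2)])
  then have s1: "(P, ?P) \<in> same_partition M l" by (rule mem[OF p])
  have "?Q \<in> q" by (rule someI[of "\<lambda>Q. Q \<in> q", OF q(2)])
  then have s2: "(Q, ?Q) \<in> same_partition M l" by (rule mem[OF q])
  have e: "P \<in> enum_partitions M l" "?P \<in> enum_partitions M l"
    "Q \<in> enum_partitions M l" "?Q \<in> enum_partitions M l"
    using sub[OF s1] sub[OF s2] by blast+
  have z: "enum_dist M l P ?P = 0" "enum_dist M l Q ?Q = 0"
    using s1 s2 enum_dist_eq_0_iff[OF assms(1) e(1,2)] enum_dist_eq_0_iff[OF assms(1) e(3,4)]
    by blast+
  note tri = enum_dist_triangle[OF assms(1), where l = l]
  have "enum_dist M l P Q \<le> enum_dist M l ?P ?Q"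
    using tri[of P ?P Q] tri[of ?P ?Q Q] e z enum_dist_commute[of M l ?Q Q] by linarith
  moreover have "enum_dist M l ?P ?Q \<le> enum_dist M l P Q"
    using tri[of ?P P ?Q] tri[of P Q ?Q] e z enum_dist_commute[of M l ?P P] by linarith
  ultimately show ?thesis
    by (simp add: rokhlin_dist_def)
qed

lemma Metric_space_partition_space:
  assumes "prob_space M"
  shows "Metric_space (partition_space M l) (rokhlin_dist M l)"
proof -
  note eq = equiv_same_partition[OF assms, of l]
  have rep: "\<exists>P. P \<in> p \<and> P \<in> enum_partitions M l" if "p \<in> partition_space M l" for p
    using that in_quotient_imp_non_empty[OF eq, of p] in_quotient_imp_subset[OF eq, of p]
    unfolding partition_space_def by blast
  show ?thesis
  proof
    show "0 \<le> rokhlin_dist M l p q" for p q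
      by (simp add: rokhlin_dist_def enum_dist_nonneg)
    show "rokhlin_dist M l p q = rokhlin_dist M l q p" for p q
      by (simp add: rokhlin_dist_def enum_dist_commute)
  next
    fix p q assume pq: "p \<in> partition_space M l" "q \<in> partition_space M l"
    obtain P Q where PQ: "P \<in> p" "P \<in> enum_partitions M l" "Q \<in> q" "Q \<in> enum_partitions M l"
      using rep pq by meson
    have "rokhlin_dist M l p q = 0 \<longleftrightarrow> (P, Q) \<in> same_partition M l"
      using rokhlin_dist_eq[OF assms pq(1) PQ(1) pq(2) PQ(3)] enum_dist_eq_0_iff[OF assms PQ(2,4)]
      by simp
    also have "\<dots> \<longleftrightarrow> p = q"
      using quotient_eq_iff[OF eq, of p q P Q] pq PQ by (auto simp: partition_space_def)
    finally show "rokhlin_dist M l p q = 0 \<longleftrightarrow> p = q" .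
  next
    fix p q r
    assume pqr: "p \<in> partition_space M l" "q \<in> partition_space M l" "r \<in> partition_space M l"
    obtain P Q R where PQR: "P \<in> p" "P \<in> enum_partitions M l" "Q \<in> q" "Q \<in> enum_partitions M l"
      "R \<in> r" "R \<in> enum_partitions M l"
      using rep pqr by meson
    show "rokhlin_dist M l p r \<le> rokhlin_dist M l p q + rokhlin_dist M l q r"
      using enum_dist_triangle[OF assms PQR(2,4,6)]
        rokhlin_dist_eq[OF assms pqr(1) PQR(1) pqr(2) PQR(3)]
        rokhlin_dist_eq[OF assms pqr(2) PQR(3) pqr(3) PQR(5)]
        rokhlin_dist_eq[OF assms pqr(1) PQR(1) pqr(3) PQR(5)]
      by simp
  qed
qed

end

theory Submission
  imports Defs
begin

text \<open>
  For \<open>k \<ge> 1\<close> consider the partitions with the following property: there is \<open>N \<ge> k\<close> such that for all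
  lengths \<open>n\<close> between \<open>N\<close> and \<open>k * N\<close> every one of the \<open>l^n\<close> words of length \<open>n\<close> has positive measure, and the
  points that meet the word \<open>B\<close> at some time up to \<open>k / \<mu>[B]\<close> have measure less than \<open>1 / k\<^sup>2\<close>
  (\<open>clustered\<close>). The measure of these points bounds \<open>F\<^sub>B(k)\<close>, so if a partition has the property for all
  \<open>k\<close>, with lengths from \<open>N k\<close> to \<open>k * N k\<close>, the union of these intervals of lengths has upper density
  one and is the set that is asked for (\<open>clustering_partition_entry_cdf\<close>). It remains to see that the
  partitions with the property for a fixed \<open>k\<close> form a dense open set; the Rokhlin metric is complete
  (\<open>mcomplete_partition_space\<close>), and Baire's theorem gives the residual set.

  The set is open (\<open>clustered_open\<close>) because the property consists of finitely many strict inequalities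
  between measures that depend continuously on the partition. For this it is essential that the property
  speaks about all words and makes them all occur.

  The set is dense (\<open>clustered_dense\<close>) by the following construction. Take a set \<open>A\<close> of very small
  positive measure, which exists because \<open>T\<close> is aperiodic, and let \<open>\<tau>\<close> be the time until the orbit reaches
  \<open>A\<close>, finite almost everywhere by ergodicity. Along an orbit \<open>\<tau>\<close> counts down, and its residues modulo any
  \<open>m\<close> are almost uniformly distributed (\<open>measure_clock_mod\<close>). Divide the values of \<open>\<tau>\<close> into epochs of length
  \<open>S\<close>, numbered cyclically by \<open>0..R-1\<close> with \<open>R\<close> large. In epoch 0 overwrite the letters with a periodic word
  that contains all words of length at most \<open>k * N\<close>. This gives every word a measure bounded below
  independently of \<open>S\<close>, hence a bound \<open>J\<close> for the relevant waiting times that is independent of \<open>S\<close>. In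
  every other epoch keep the letters up to a sparse set of positions, where runs of the letter 1 of a
  length characteristic of the epoch are planted (\<open>clock_letter\<close>). A word of length at least \<open>N\<close> contains
  such a run and so occurs inside at most one epoch besides epoch 0 (\<open>clock_letter_run_type\<close>). If \<open>S\<close> is much
  larger than \<open>J\<close>, the points that meet the word within time \<open>J\<close> lie, up to a small error, in two of
  the \<open>R\<close> epochs.
\<close>

section \<open>Reading the generated process along forward orbits\<close>

definition spells :: "'a measure \<Rightarrow> ('a \<Rightarrow> 'a) \<Rightarrow> ('a \<Rightarrow> nat) \<Rightarrow> nat list \<Rightarrow> 'a set" where
  "spells M T c B = {x \<in> space M. \<forall>j<length B. c ((T ^^ j) x) = B ! j}"

definition meets :: "'a measure \<Rightarrow> ('a \<Rightarrow> 'a) \<Rightarrow> nat \<Rightarrow> 'a set \<Rightarrow> 'a set" where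
  "meets M T J A = {x \<in> space M. \<exists>j\<in>{1..J}. (T ^^ j) x \<in> A}"

text \<open>
  The set of points that meet \<open>B\<close> at one of the times \<open>1..J\<close> is, as soon as \<open>J + 1\<close>
  exceeds \<open>k / \<mu>[B]\<close>, a superset of the event in the distribution function at \<open>k\<close>. A common \<open>J\<close>
  for all words replaces the jumping bound \<open>\<lfloor>k / \<mu>[B]\<rfloor>\<close>, so that the condition consists of finitely
  many strict inequalities between measures. It is imposed on all words over the alphabet, and its
  first half forces each of them to have positive measure. If it were imposed only on the words that
  occur, it would be destroyed by small perturbations, which can create new rare words that show no
  clustering.
\<close>

definition clustered ::
    "'a measure \<Rightarrow> ('a \<Rightarrow> 'a) \<Rightarrow> nat \<Rightarrow> ('a \<Rightarrow> nat) \<Rightarrow> nat \<Rightarrow> nat \<Rightarrow> nat \<Rightarrow> bool" where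
  "clustered M T l c k N J \<longleftrightarrow>
    (\<forall>n\<in>{N..k * N}. \<forall>B\<in>blocks l n.
      real k < real (J + 1) * measure M (spells M T c B) \<and>
      measure M (meets M T J (spells M T c B)) < 1 / (real k)\<^sup>2)"

lemma finite_blocks: "finite (blocks l n)"
proof -
  have "blocks l n = {B. set B \<subseteq> {1..l} \<and> length B = n}"
    by (auto simp: blocks_def)
  then show ?thesis
    using finite_lists_length_eq[of "{1..l}" n] by simp
qed

locale mp_system = prob_space M for M :: "'a measure" +
  fixes T :: "'a \<Rightarrow> 'a"
  assumes T_measurable [measurable]: "T \<in> measurable M M"
    and distr_T: "distr M M T = M"
begin

lemma funpow_measurable [measurable]: "T ^^ n \<in> measurable M M"
proof (induction n)
  case 0
  then show ?case by (simp add: id_def)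
next
  case (Suc n)
  then show ?case by (simp add: o_def)
qed

lemma funpow_space: "x \<in> space M \<Longrightarrow> (T ^^ n) x \<in> space M"
  using measurable_space[OF funpow_measurable] .

lemma distr_funpow: "distr M M (T ^^ n) = M"
proof (induction n)
  case 0
  then show ?case by (simp add: id_def)
next
  case (Suc n)
  have "distr M M (T ^^ Suc n) = distr (distr M M (T ^^ n)) M T"
    by (subst distr_distr) (auto simp del: funpow.simps simp: funpow.simps(2))
  then show ?case by (simp only: Suc distr_T)
qed

lemma measure_preimage:
  assumes "A \<in> sets M"
  shows "measure M ((T ^^ n) -` A \<inter> space M) = measure M A"
  using measure_distr[OF funpow_measurable assms, of n] by (simp add: distr_funpow)

lemma spells_sets [measurable]:
  assumes [measurable]: "c \<in> measurable M (count_space UNIV)"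
  shows "spells M T c B \<in> sets M"
  unfolding spells_def by measurable

lemma meets_eq: "meets M T J A = (\<Union>j\<in>{1..J}. (T ^^ j) -` A \<inter> space M)"
  by (auto simp: meets_def)

lemma meets_sets [measurable]:
  assumes "A \<in> sets M"
  shows "meets M T J A \<in> sets M"
  unfolding meets_eq using assms by (auto intro: measurable_sets)

end

lemma cell_index_eqI:
  assumes "P \<in> enum_partitions M l" "i \<in> {1..l}" "x \<in> P i"
  shows "cell_index l P x = i"
proof -
  have x: "x \<in> space M"
    using assms by (auto simp: enum_partitions_def)
  have "disjoint_family_on P {1..l}"
    using assms(1) by (simp add: enum_partitions_def)
  from disjoint_family_onD[OF this, of "cell_index l P x" i]
  show ?thesis using cell_index[OF assms(1) x] assms by blast
qed

lemma cell_index_measurable: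
  assumes "P \<in> enum_partitions M l"
  shows "cell_index l P \<in> measurable M (count_space UNIV)"
  unfolding measurable_count_space_eq2_countable
proof (intro conjI ballI)
  fix i :: nat
  have "cell_index l P -` {i} \<inter> space M = (if i \<in> {1..l} then P i else {})"
  proof (intro set_eqI iffI)
    fix x assume "x \<in> cell_index l P -` {i} \<inter> space M"
    then show "x \<in> (if i \<in> {1..l} then P i else {})"
      using cell_index[OF assms, of x] by auto
  next
    fix x assume "x \<in> (if i \<in> {1..l} then P i else {})"
    then have i: "i \<in> {1..l}" "x \<in> P i"
      by (auto split: if_splits)
    then have "x \<in> space M"
      using assms by (auto simp: enum_partitions_def)
    then show "x \<in> cell_index l P -` {i} \<inter> space M"
      using cell_index_eqI[OF assms i] by simp
  qed
  also have "\<dots> \<in> sets M"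
    using assms by (auto simp: enum_partitions_def)
  finally show "cell_index l P -` {i} \<inter> space M \<in> sets M" .
qed simp

lemma left_shift_funpow: "(left_shift ^^ k) y j = y (j + int k)"
  by (induction k arbitrary: j) (auto simp: left_shift_def algebra_simps)

text \<open>
  For an arbitrary map \<open>f\<close> the image measure is defined by preimages whenever these form a measure,
  and is zero otherwise. A single set of positive measure therefore shows that all values are given by
  preimages.
\<close>

lemma measure_distr_cases:
  obtains (zero) "\<And>A. measure (distr M N f) A = 0"
  | (pull_back) "\<And>A. A \<in> sets N \<Longrightarrow> measure (distr M N f) A = measure M (f -` A \<inter> space M)"
proof (cases "measure_space (space N) (sets N) (\<lambda>A. emeasure M (f -` A \<inter> space M))")
  case True
  then show ?thesis
    by (intro pull_back) (simp add: measure_def distr_def emeasure_measure_of_conv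
        sets.sigma_sets_eq)
next
  case False
  then show ?thesis
    by (intro zero) (simp add: measure_def distr_def emeasure_measure_of_conv
        sets.sigma_sets_eq)
qed

lemma entry_time_finite:
  assumes "0 < m" "ereal m * ereal_of_enat (entry_time l B y) \<le> ereal t"
  obtains j where "1 \<le> j" "(left_shift ^^ j) y \<in> cylinder l B" "m * real j \<le> t"
proof -
  let ?K = "{k. 1 \<le> k \<and> (left_shift ^^ k) y \<in> cylinder l B}"
  have "?K \<noteq> {}"
  proof
    assume "?K = {}"
    then have "entry_time l B y = \<infinity>"
      unfolding entry_time_def by (metis INF_empty top_enat_def)
    then show False using assms by simp
  qed
  then have "entry_time l B y \<in> enat ` ?K"
    unfolding entry_time_def by (metis (no_types, lifting) wellorder_InfI image_is_empty ex_in_conv)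
  then obtain j where "j \<in> ?K" "entry_time l B y = enat j"
    by auto
  then show ?thesis using assms that[of j] by auto
qed

context mp_system
begin

lemma itinerary_in_sequence_space:
  assumes "ae_injective M T" and P: "P \<in> enum_partitions M l" and x: "x \<in> space M"
  shows "itinerary M T l P x \<in> space (sequence_space l)"
proof -
  have "(ae_inverse M T ^^ k) x \<in> space M" for k
    using x ae_inverse(1)[OF prob_space_axioms assms(1)] by (induction k) auto
  then have "int_iterate M T k x \<in> space M" for k
    using funpow_space[OF x] by (simp add: int_iterate_def)
  then show ?thesis
    using cell_index(1)[OF P]
    by (auto simp: itinerary_def sequence_space_def space_PiM PiE_iff)
qed

lemma itinerary_cylinder:
  assumes "ae_injective M T" and P: "P \<in> enum_partitions M l" and x: "x \<in> space M"
  shows "(left_shift ^^ k) (itinerary M T l P x) \<in> cylinder l B \<longleftrightarrow>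
    (T ^^ k) x \<in> spells M T (cell_index l P) B"
proof -
  have "(left_shift ^^ k) (itinerary M T l P x) \<in> space (sequence_space l)"
    using itinerary_in_sequence_space[OF assms]
    by (auto simp: sequence_space_def space_PiM PiE_iff left_shift_funpow)
  moreover have "itinerary M T l P x (int j + int k) = cell_index l P ((T ^^ j) ((T ^^ k) x))" for j
    by (simp add: itinerary_def int_iterate_def nat_add_distrib funpow_add)
  ultimately show ?thesis
    using funpow_space[OF x] by (auto simp: cylinder_def spells_def left_shift_funpow)
qed

text \<open>
  Both the cylinder of a block and the event that its entry time is small constrain the nonnegative
  coordinates only, so the generated process can be replaced by forward orbits of \<open>T\<close>.
\<close>

lemma entry_cdf_le_measure_meets:
  assumes "ae_injective M T" and P: "P \<in> enum_partitions M l"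
    and pos: "measure (process_measure M T l P) (cylinder l B) > 0"
    and J: "t < real (J + 1) * measure M (spells M T (cell_index l P) B)"
  shows "entry_cdf (process_measure M T l P) l B t
    \<le> measure M (meets M T J (spells M T (cell_index l P) B))"
proof -
  let ?\<nu> = "process_measure M T l P" and ?f = "itinerary M T l P"
    and ?C = "spells M T (cell_index l P) B"
  have [measurable]: "cell_index l P \<in> measurable M (count_space UNIV)"
    by (rule cell_index_measurable[OF P])
  have pull: "measure ?\<nu> A = measure (completion M) (?f -` A \<inter> space M)"
    if "A \<in> sets (sequence_space l)" for A
    using pos that unfolding process_measure_def
    by (cases "completion M" "sequence_space l" ?f rule: measure_distr_cases) auto
  have "cylinder l B \<in> sets ?\<nu>"
    using pos by (metis measure_notin_sets less_irrefl)
  then have cyl: "cylinder l B \<in> sets (sequence_space l)"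
    by (simp add: process_measure_def)
  have "?f -` cylinder l B \<inter> space M = ?C"
    using itinerary_cylinder[OF assms(1) P, where k = 0 and B = B] by (auto simp: spells_def)
  then have eq: "measure ?\<nu> (cylinder l B) = measure M ?C"
    by (simp add: pull[OF cyl])
  let ?E = "{y \<in> space ?\<nu>. ereal (measure ?\<nu> (cylinder l B)) * ereal_of_enat (entry_time l B y)
    \<le> ereal t}"
  show ?thesis
  proof (cases "?E \<in> sets (sequence_space l)")
    case False
    then have "?E \<notin> sets ?\<nu>"
      by (simp add: process_measure_def)
    then show ?thesis
      unfolding entry_cdf_def by (subst measure_notin_sets) auto
  next
    case True
    \<comment> \<open>A time \<open>j\<close> with \<open>\<mu>[B] * j \<le> t < \<mu>[B] * (J + 1)\<close> is at most \<open>J\<close>.\<close>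
    have "?f -` ?E \<inter> space M \<subseteq> meets M T J ?C"
    proof
      fix x assume x: "x \<in> ?f -` ?E \<inter> space M"
      then obtain j where j: "1 \<le> j" "(left_shift ^^ j) (?f x) \<in> cylinder l B"
          "measure M ?C * real j \<le> t"
        using entry_time_finite[OF pos, of l B "?f x" t] by (auto simp: eq)
      have "measure M ?C * real j < measure M ?C * real (J + 1)"
        using j(3) J by (simp add: mult.commute)
      then have "j \<le> J"
          by (simp add: mult_less_cancel_left)
      then show "x \<in> meets M T J ?C"
        using j x itinerary_cylinder[OF assms(1) P] by (auto simp: meets_def)
    qed
    then have "measure (completion M) (?f -` ?E \<inter> space M) \<le> measure (completion M) (meets M T J ?C)"
      by (intro finite_measure.finite_measure_mono finite_measureI)
        (auto simp: emeasure_space_1)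
    then show ?thesis
      unfolding entry_cdf_def by (simp add: pull[OF True])
  qed
qed

end

section \<open>Clustering is an open condition\<close>

text \<open>
  Points of the partition space carry no enumeration, so nearness of two partitions means nearness of
  their colourings after a permutation of the letters. Permuting the letters of the words as well
  leaves the occurrence sets unchanged.
\<close>

lemma spells_relabel:
  assumes "inj_on \<pi> (c ` space M \<union> set B)" "\<And>x. x \<in> space M \<Longrightarrow> T x \<in> space M"
  shows "spells M T (\<pi> \<circ> c) (map \<pi> B) = spells M T c B"
proof -
  have orbit: "(T ^^ j) x \<in> space M" if "x \<in> space M" for j x
    using that assms(2) by (induction j) auto
  have "\<pi> (c ((T ^^ j) x)) = \<pi> (B ! j) \<longleftrightarrow> c ((T ^^ j) x) = B ! j"
    if "x \<in> space M" "j < length B" for x j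
    using that orbit by (intro inj_on_eq_iff[OF assms(1)]) auto
  then show ?thesis
    by (auto simp: spells_def)
qed

lemma meets_Un_subset:
  assumes "A \<subseteq> A' \<union> U"
  shows "meets M T J A \<subseteq> meets M T J A' \<union> meets M T J U"
  using assms by (auto simp: meets_def)

context mp_system
begin

definition differ :: "('a \<Rightarrow> nat) \<Rightarrow> ('a \<Rightarrow> nat) \<Rightarrow> 'a set" where
  "differ c c' = {x \<in> space M. c x \<noteq> c' x}"

lemma differ_sets [measurable]:
  assumes [measurable]: "c \<in> measurable M (count_space UNIV)" "c' \<in> measurable M (count_space UNIV)"
  shows "differ c c' \<in> sets M"
proof -
  have "differ c c' = (\<Union>i. (c -` {i} \<inter> space M) - (c' -` {i} \<inter> space M))"
    by (auto simp: differ_def)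
  also have "\<dots> \<in> sets M"
    using measurable_sets[OF assms(1)] measurable_sets[OF assms(2)]
    by (intro sets.countable_UN'' sets.Diff) auto
  finally show ?thesis .
qed

text \<open>
  Two colourings spell the same word at \<open>x\<close> unless the orbit of \<open>x\<close> visits the set where they differ
  during the time that the word takes. By invariance this set costs its measure once for each letter.
\<close>

lemma measure_spells_le:
  assumes [measurable]: "c \<in> measurable M (count_space UNIV)" "c' \<in> measurable M (count_space UNIV)"
  shows "measure M (spells M T c B)
    \<le> measure M (spells M T c' B) + real (length B) * measure M (differ c c')"
proof -
  let ?U = "\<Union>j<length B. (T ^^ j) -` differ c c' \<inter> space M"
  have sets: "(T ^^ j) -` differ c c' \<inter> space M \<in> sets M" for j
    by measurable
  have "spells M T c B \<subseteq> spells M T c' B \<union> ?U"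
    using funpow_space by (auto simp: spells_def differ_def)
  then have "measure M (spells M T c B) \<le> measure M (spells M T c' B \<union> ?U)"
    using sets by (intro finite_measure_mono) auto
  also have "\<dots> \<le> measure M (spells M T c' B) + measure M ?U"
    using sets by (intro measure_Un_le) auto
  also have "measure M ?U \<le> (\<Sum>j<length B. measure M ((T ^^ j) -` differ c c' \<inter> space M))"
    using sets by (intro measure_UNION_le) auto
  also have "\<dots> = real (length B) * measure M (differ c c')"
    by (simp add: measure_preimage)
  finally show ?thesis by simp
qed

lemma measure_meets_spells_le:
  assumes [measurable]: "c \<in> measurable M (count_space UNIV)" "c' \<in> measurable M (count_space UNIV)"
  shows "measure M (meets M T J (spells M T c B))
    \<le> measure M (meets M T J (spells M T c' B)) + real J * (real (length B) * measure M (differ c c'))"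
proof -
  let ?U = "\<Union>j<length B. (T ^^ j) -` differ c c' \<inter> space M"
  have sets: "(T ^^ j) -` differ c c' \<inter> space M \<in> sets M" for j
    by measurable
  then have U: "?U \<in> sets M" by auto
  have "spells M T c B \<subseteq> spells M T c' B \<union> ?U"
    using funpow_space by (auto simp: spells_def differ_def)
  then have "meets M T J (spells M T c B) \<subseteq> meets M T J (spells M T c' B) \<union> meets M T J ?U"
    by (rule meets_Un_subset)
  moreover have ms: "meets M T J (spells M T c' B) \<in> sets M" "meets M T J ?U \<in> sets M"
    by (intro meets_sets U spells_sets assms)+
  ultimately have "measure M (meets M T J (spells M T c B))
      \<le> measure M (meets M T J (spells M T c' B) \<union> meets M T J ?U)"
    by (intro finite_measure_mono sets.Un)
  also have "\<dots> \<le> measure M (meets M T J (spells M T c' B)) + measure M (meets M T J ?U)"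
    by (intro measure_Un_le ms)
  also have "measure M (meets M T J ?U) \<le> (\<Sum>j\<in>{1..J}. measure M ((T ^^ j) -` ?U \<inter> space M))"
    unfolding meets_eq by (intro measure_UNION_le finite_atLeastAtMost measurable_sets[OF funpow_measurable U])
  also have "\<dots> = real J * measure M ?U"
    unfolding measure_preimage[OF U] by (simp del: UN_simps)
  also have "measure M ?U \<le> (\<Sum>j<length B. measure M ((T ^^ j) -` differ c c' \<inter> space M))"
    using sets by (intro measure_UNION_le) auto
  also have "\<dots> = real (length B) * measure M (differ c c')"
    by (simp add: measure_preimage)
  finally show ?thesis by (simp add: mult_left_mono)
qed

text \<open>
  Each of the finitely many inequalities leaves a gap, and a change of the partition by \<open>\<delta>\<close> moves
  its two sides by at most \<open>(J + 1) * k * N * \<delta>\<close> against each other.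
\<close>

lemma clustered_open:
  assumes P: "P \<in> enum_partitions M l" and cl: "clustered M T l (cell_index l P) k N J"
  obtains \<delta> where "0 < \<delta>"
    "\<And>Q. Q \<in> enum_partitions M l \<Longrightarrow> enum_dist M l P Q < \<delta> \<Longrightarrow> clustered M T l (cell_index l Q) k N J"
proof -
  let ?c = "cell_index l P"
  let ?Bs = "\<Union>n\<in>{N..k * N}. blocks l n"
  define K where "K = real (J + 1) * (real (k * N) + 1)"
  define gap where "gap B = min (real (J + 1) * measure M (spells M T ?c B) - real k)
    (1 / (real k)\<^sup>2 - measure M (meets M T J (spells M T ?c B)))" for B
  have fin: "finite (insert 1 (gap ` ?Bs))"
    by (simp add: finite_blocks)
  define \<delta> where "\<delta> = Min (insert 1 (gap ` ?Bs)) / K"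
  have K: "0 < K" unfolding K_def by (intro mult_pos_pos add_nonneg_pos) auto
  have "0 < gap B" if B: "B \<in> ?Bs" for B
  proof -
    obtain n where "n \<in> {N..k * N}" "B \<in> blocks l n"
      using B by blast
    then show ?thesis
      using cl unfolding clustered_def gap_def by simp
  qed
  then have pos: "0 < \<delta>"
    using fin K unfolding \<delta>_def by (intro divide_pos_pos) auto
  show thesis
  proof (rule that[OF pos])
    fix Q assume Q: "Q \<in> enum_partitions M l" "enum_dist M l P Q < \<delta>"
    obtain \<pi> where \<pi>: "\<pi> permutes {1..l}"
      "enum_dist M l P Q = (\<Sum>i\<in>{1..l}. measure M (sym_diff (P i) (Q (\<pi> i))))"
      by (rule enum_dist_attained)
    have bij: "bij \<pi>" by (rule permutes_bij[OF \<pi>(1)])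
    let ?d = "cell_index l Q"
    \<comment> \<open>The optimal permutation matches the cells of \<open>P\<close> with those of \<open>Q\<close>; words for \<open>Q\<close> correspond to
      words for \<open>P\<close> under its inverse.\<close>
    define c where "c = \<pi> \<circ> ?c"
    have [measurable]: "?c \<in> measurable M (count_space UNIV)" "?d \<in> measurable M (count_space UNIV)"
      using P Q(1) by (auto intro: cell_index_measurable)
    have [measurable]: "c \<in> measurable M (count_space UNIV)"
      unfolding c_def by measurable
    have ms: "sym_diff (P i) (Q (\<pi> i)) \<in> sets M" if "i \<in> {1..l}" for i
    proof -
      have "\<pi> i \<in> {1..l}"
        using that permutes_in_image[OF \<pi>(1)] by simp
      then have "P i \<in> sets M" "Q (\<pi> i) \<in> sets M"
        using that P Q(1) by (simp_all add: enum_partitions_def)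
      then show ?thesis by (intro sets.Un sets.Diff)
    qed
    have "differ c ?d \<subseteq> (\<Union>i\<in>{1..l}. sym_diff (P i) (Q (\<pi> i)))"
    proof
      fix x assume "x \<in> differ c ?d"
      then have x: "x \<in> space M" "\<pi> (?c x) \<noteq> ?d x"
        by (auto simp: differ_def c_def)
      have "?c x \<in> {1..l}" "x \<in> P (?c x)"
        using cell_index[OF P x(1)] .
      moreover have "x \<notin> Q (\<pi> (?c x))"
        using x(2) cell_index_eqI[OF Q(1), of "\<pi> (?c x)" x] permutes_in_image[OF \<pi>(1), of "?c x"]
          \<open>?c x \<in> {1..l}\<close> by auto
      ultimately show "x \<in> (\<Union>i\<in>{1..l}. sym_diff (P i) (Q (\<pi> i)))"
        by blast
    qed
    then have "measure M (differ c ?d) \<le> measure M (\<Union>i\<in>{1..l}. sym_diff (P i) (Q (\<pi> i)))"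
      using ms by (intro finite_measure_mono) auto
    also have "\<dots> \<le> enum_dist M l P Q"
      unfolding \<pi>(2) using ms by (intro measure_UNION_le) auto
    finally have near: "measure M (differ c ?d) < \<delta>"
      using Q(2) by simp
    have sym: "differ ?d c = differ c ?d"
      by (auto simp: differ_def)
    show "clustered M T l ?d k N J"
      unfolding clustered_def
    proof (intro ballI)
      fix n B assume n: "n \<in> {N..k * N}" and B: "B \<in> blocks l n"
      define B' where "B' = map (inv \<pi>) B"
      have len: "length B = n" "length B' = n"
        using B by (auto simp: B'_def blocks_def)
      have map_B': "map \<pi> B' = B"
        using bij by (simp add: B'_def o_def bij_is_surj surj_f_inv_f)
      have "set B' \<subseteq> {1..l}"
        using B permutes_in_image[OF permutes_inv[OF \<pi>(1)]] by (auto simp: B'_def blocks_def)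
      then have "B' \<in> blocks l n"
        using len by (simp add: blocks_def)
      then have "B' \<in> ?Bs" using n by blast
      then have "Min (insert 1 (gap ` ?Bs)) \<le> gap B'"
        using fin by (intro Min_le) auto
      then have gap: "\<delta> * K \<le> gap B'"
        using K by (simp add: \<delta>_def)
      have eq: "spells M T ?c B' = spells M T c B"
        using spells_relabel[OF inj_on_subset[OF bij_is_inj[OF bij] subset_UNIV], of M T ?c B']
          measurable_space[OF T_measurable] by (simp add: c_def map_B')
      let ?e = "measure M (differ c ?d)"
      have n_le: "real n \<le> real (k * N)" using n by (simp del: of_nat_mult)
      have "real (J + 1) * (real n * ?e) \<le> real (J + 1) * ((real (k * N) + 1) * ?e)"
        using n_le by (intro mult_left_mono mult_right_mono) auto
      also have "\<dots> < \<delta> * K"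
      proof -
        have "real (J + 1) * ((real (k * N) + 1) * ?e) = K * ?e"
          unfolding K_def by (rule mult.assoc[symmetric])
        also have "\<dots> < K * \<delta>"
          using near K by (rule mult_strict_left_mono)
        finally show ?thesis by (simp only: mult.commute)
      qed
      finally have err: "real (J + 1) * (real n * ?e) < gap B'"
        using gap by linarith
      have "measure M (spells M T c B) \<le> measure M (spells M T ?d B) + real n * ?e"
        using measure_spells_le[of c ?d B] by (simp add: len)
      then have "real (J + 1) * measure M (spells M T c B)
          \<le> real (J + 1) * (measure M (spells M T ?d B) + real n * ?e)"
        by (intro mult_left_mono) auto
      then have 1: "real k < real (J + 1) * measure M (spells M T ?d B)"
        using err unfolding gap_def eq distrib_left by linarith
      have "measure M (meets M T J (spells M T ?d B))
          \<le> measure M (meets M T J (spells M T c B)) + real J * (real n * ?e)"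
        using measure_meets_spells_le[of ?d c J B] by (simp add: len sym)
      also have "\<dots> \<le> measure M (meets M T J (spells M T c B)) + real (J + 1) * (real n * ?e)"
        by (intro add_left_mono mult_right_mono) auto
      finally have 2: "measure M (meets M T J (spells M T ?d B)) < 1 / (real k)\<^sup>2"
        using err unfolding gap_def eq by linarith
      show "real k < real (J + 1) * measure M (spells M T ?d B) \<and>
          measure M (meets M T J (spells M T ?d B)) < 1 / (real k)\<^sup>2"
        using 1 2 by blast
    qed
  qed
qed

end

section \<open>Completeness of the partition space\<close>

definition colour_partition :: "'a measure \<Rightarrow> ('a \<Rightarrow> nat) \<Rightarrow> nat \<Rightarrow> 'a set" where
  "colour_partition M c i = {x \<in> space M. c x = i}"

lemma colour_partition_enum:
  assumes [measurable]: "c \<in> measurable M (count_space UNIV)"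
    and "\<And>x. x \<in> space M \<Longrightarrow> c x \<in> {1..l}"
  shows "colour_partition M c \<in> enum_partitions M l"
proof -
  have "colour_partition M c i \<in> sets M" for i
    unfolding colour_partition_def by measurable
  then show ?thesis
    using assms(2) by (auto simp: enum_partitions_def disjoint_family_on_def colour_partition_def)
qed

lemma cell_index_colour_partition:
  assumes "x \<in> space M" "c x \<in> {1..l}"
  shows "cell_index l (colour_partition M c) x = c x"
  unfolding cell_index_def using assms by (intro the_equality) (auto simp: colour_partition_def)

lemma mem_cell_iff:
  assumes "P \<in> enum_partitions M l" "x \<in> space M" "i \<in> {1..l}"
  shows "x \<in> P i \<longleftrightarrow> cell_index l P x = i"
  using cell_index(2)[OF assms(1,2)] cell_index_eqI[OF assms(1,3)] by blast

context prob_space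
begin

text \<open>
  The identity permutation already gives this bound: each of the \<open>l\<close> symmetric differences lies in the
  set where the colourings disagree.
\<close>

lemma enum_dist_le_measure:
  assumes P: "P \<in> enum_partitions M l" and Q: "Q \<in> enum_partitions M l"
    and U: "U \<in> sets M" "\<And>x. x \<in> space M \<Longrightarrow> x \<notin> U \<Longrightarrow> cell_index l P x = cell_index l Q x"
  shows "enum_dist M l P Q \<le> real l * measure M U"
proof -
  have "sym_diff (P i) (Q i) \<subseteq> U" if i: "i \<in> {1..l}" for i
  proof
    fix x assume x: "x \<in> sym_diff (P i) (Q i)"
    then have xM: "x \<in> space M"
      using P Q i by (auto simp: enum_partitions_def)
    show "x \<in> U"
    proof (rule ccontr)
      assume "x \<notin> U"
      then have "cell_index l P x = cell_index l Q x"
        by (rule U(2)[OF xM])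
      then show False
        using x mem_cell_iff[OF P xM i] mem_cell_iff[OF Q xM i] by simp
    qed
  qed
  then have "(\<Sum>i\<in>{1..l}. measure M (sym_diff (P i) (Q i))) \<le> (\<Sum>i\<in>{1..l}. measure M U)"
    using U(1) by (intro sum_mono finite_measure_mono) auto
  then show ?thesis
    using enum_dist_le[where M = M and l = l and P = P and Q = Q, OF permutes_id] by simp
qed

text \<open>
  Completeness for rapidly converging, consistently enumerated partitions. By Borel-Cantelli almost
  every point changes its cell only finitely often, and its final cell defines the limit.
\<close>

lemma eventually_constant_limit:
  fixes P :: "nat \<Rightarrow> nat \<Rightarrow> 'a set"
  assumes P: "\<And>n. P n \<in> enum_partitions M l"
    and near: "\<And>n. (\<Sum>i\<in>{1..l}. measure M (sym_diff (P n i) (P (Suc n) i))) < (1 / 2) ^ n"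
  obtains Q where "Q \<in> enum_partitions M l"
    "\<And>n. enum_dist M l (P n) Q \<le> real l * (2 * (1 / 2) ^ n)"
proof -
  let ?c = "\<lambda>n. cell_index l (P n)"
  have c [measurable]: "?c n \<in> measurable M (count_space UNIV)" for n
    by (rule cell_index_measurable[OF P])
  define V where "V n = (\<Union>i\<in>{1..l}. sym_diff (P n i) (P (Suc n) i))" for n
  have ms: "sym_diff (P n i) (P (Suc n) i) \<in> sets M" if "i \<in> {1..l}" for n i
    using that P[of n] P[of "Suc n"] by (auto simp: enum_partitions_def)
  then have V: "V n \<in> sets M" for n
    unfolding V_def by (intro sets.finite_UN) auto
  have V_le: "measure M (V n) \<le> (1 / 2) ^ n" for n
  proof -
    have "measure M (V n) \<le> (\<Sum>i\<in>{1..l}. measure M (sym_diff (P n i) (P (Suc n) i)))"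
      unfolding V_def using ms by (intro measure_UNION_le) auto
    then show ?thesis using near[of n] by simp
  qed
  have same: "?c (Suc n) x = ?c n x" if x: "x \<in> space M" "x \<notin> V n" for x n
  proof -
    have "?c n x \<in> {1..l}" "x \<in> P n (?c n x)"
      using cell_index[OF P x(1)] .
    then have "x \<in> P (Suc n) (?c n x)"
      using x(2) unfolding V_def by blast
    then show ?thesis
      using cell_index_eqI[OF P] \<open>?c n x \<in> {1..l}\<close> by blast
  qed
  \<comment> \<open>Outside \<open>U n\<close> the cell of a point is constant from stage \<open>n\<close> on.\<close>
  define U where "U n = (\<Union>m. V (m + n))" for n
  have U: "U n \<in> sets M" for n
    unfolding U_def using V by auto
  have geo: "(\<lambda>m. (1 / 2 :: real) ^ (m + n)) sums (2 * (1 / 2) ^ n)" for n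
    using sums_mult[OF geometric_sums[of "1 / 2 :: real"], of "(1 / 2) ^ n"]
    by (simp add: power_add mult.commute)
  have U_le: "measure M (U n) \<le> 2 * (1 / 2) ^ n" for n
  proof -
    have summable: "summable (\<lambda>m. measure M (V (m + n)))"
      using V_le by (intro summable_comparison_test'[OF sums_summable[OF geo[of n]]]) auto
    have "measure M (U n) \<le> (\<Sum>m. measure M (V (m + n)))"
      unfolding U_def using V by (intro finite_measure_subadditive_countably summable) auto
    also have "\<dots> \<le> (\<Sum>m. (1 / 2) ^ (m + n))"
      using V_le by (intro suminf_le summable sums_summable[OF geo[of n]]) auto
    also have "\<dots> = 2 * (1 / 2) ^ n"
      using geo[of n] by (rule sums_unique[symmetric])
    finally show ?thesis .
  qed
  have stable: "?c m x = ?c n x" if "x \<in> space M" "x \<notin> U n" "n \<le> m" for x n m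
    using that(3)
  proof (induction m rule: dec_induct)
    case (step m)
    have "x \<notin> V (m - n + n)"
      using that(2) unfolding U_def by blast
    then have "x \<notin> V m"
      using step(1) by simp
    then show ?case using same[OF that(1)] step by simp
  qed simp
  \<comment> \<open>On the intersection of all \<open>U n\<close>, which is a null set, the value is arbitrary.\<close>
  define d where "d x = (if \<exists>n. x \<notin> U n then ?c (LEAST n. x \<notin> U n) x else ?c 0 x)" for x
  have d_eq: "d x = ?c n x" if "x \<in> space M" "x \<notin> U n" for x n
  proof -
    have "x \<notin> U (LEAST n. x \<notin> U n)" "(LEAST n. x \<notin> U n) \<le> n"
      using that(2) by (rule LeastI[of "\<lambda>n. x \<notin> U n"], rule Least_le[of "\<lambda>n. x \<notin> U n"])
    then show ?thesis
      using stable[OF that(1)] that(2) unfolding d_def by metis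
  qed
  have [measurable]: "d \<in> measurable M (count_space UNIV)"
  proof -
    have [measurable]: "U n \<in> sets M" for n by (rule U)
    have 1: "(\<lambda>x. LEAST n. x \<notin> U n) \<in> measurable M (count_space UNIV)"
      by measurable
    have 2: "(\<lambda>x. ?c (LEAST n. x \<notin> U n) x) \<in> measurable M (count_space UNIV)"
      by (rule measurable_compose_countable[OF c 1])
    show ?thesis
      unfolding d_def[abs_def] using 2 by measurable
  qed
  have d_range: "d x \<in> {1..l}" if "x \<in> space M" for x
    using cell_index(1)[OF P that] by (simp add: d_def)
  define Q where "Q = colour_partition M d"
  have Q: "Q \<in> enum_partitions M l"
    unfolding Q_def using d_range by (intro colour_partition_enum) auto
  have "enum_dist M l (P n) Q \<le> real l * measure M (U n)" for n
  proof (rule enum_dist_le_measure[OF P Q U])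
    fix x assume x: "x \<in> space M" "x \<notin> U n"
    show "cell_index l (P n) x = cell_index l Q x"
      using d_eq[OF x] cell_index_colour_partition[where c = d, OF x(1) d_range[OF x(1)]] by (simp add: Q_def)
  qed
  then have "enum_dist M l (P n) Q \<le> real l * (2 * (1 / 2) ^ n)" for n
    using U_le[of n] by (meson mult_left_mono of_nat_0_le_iff order_trans)
  with Q show thesis by (rule that)
qed

lemma partition_space_representative:
  assumes "p \<in> partition_space M l"
  obtains P where "P \<in> p"
  using assms in_quotient_imp_non_empty[OF equiv_same_partition[OF prob_space_axioms]]
  unfolding partition_space_def by blast

lemma partition_space_member:
  assumes "p \<in> partition_space M l" "P \<in> p"
  shows "P \<in> enum_partitions M l"
  using assms in_quotient_imp_subset[OF equiv_same_partition[OF prob_space_axioms]]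
  unfolding partition_space_def by blast

lemma partition_space_class:
  assumes "P \<in> enum_partitions M l"
  shows "same_partition M l `` {P} \<in> partition_space M l" "P \<in> same_partition M l `` {P}"
  using assms equiv_class_self[OF equiv_same_partition[OF prob_space_axioms]]
  unfolding partition_space_def by (auto intro: quotientI)

text \<open>
  Renumbering the cells does not leave the class. This allows the enumerations along a Cauchy sequence
  to be chosen one after the other so that consecutive ones match.
\<close>

lemma permute_cells:
  assumes P: "P \<in> enum_partitions M l" and \<pi>: "\<pi> permutes {1..l}"
  shows "(P \<circ> \<pi>) \<in> enum_partitions M l" "(P, P \<circ> \<pi>) \<in> same_partition M l"
proof -
  have im: "\<pi> ` {1..l} = {1..l}" by (rule permutes_image[OF \<pi>])
  have "disjoint_family_on (P \<circ> \<pi>) {1..l}"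
    unfolding disjoint_family_on_def
  proof (intro ballI impI)
    fix i j assume ij: "i \<in> {1..l}" "j \<in> {1..l}" "i \<noteq> j"
    then have "\<pi> i \<noteq> \<pi> j" "\<pi> i \<in> {1..l}" "\<pi> j \<in> {1..l}"
      using permutes_inj[OF \<pi>] im by (auto dest: injD)
    then show "(P \<circ> \<pi>) i \<inter> (P \<circ> \<pi>) j = {}"
      using P disjoint_family_onD[of P "{1..l}"] by (auto simp: enum_partitions_def)
  qed
  moreover have "(\<Union>i\<in>{1..l}. (P \<circ> \<pi>) i) = (\<Union>i\<in>\<pi> ` {1..l}. P i)"
    by (simp add: image_image)
  moreover have "\<forall>i\<in>{1..l}. (P \<circ> \<pi>) i \<in> sets M"
    using P im by (auto simp: enum_partitions_def)
  ultimately show *: "(P \<circ> \<pi>) \<in> enum_partitions M l"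
    using P unfolding im by (simp add: enum_partitions_def)
  show "(P, P \<circ> \<pi>) \<in> same_partition M l"
    unfolding same_partition_def using P * permutes_inv[OF \<pi>] permutes_inverses(1)[OF \<pi>]
    by (auto intro!: exI[of _ "inv \<pi>"])
qed

lemma mcomplete_partition_space:
  "Metric_space.mcomplete (partition_space M l) (rokhlin_dist M l)"
proof -
  interpret Metric_space "partition_space M l" "rokhlin_dist M l"
    by (rule Metric_space_partition_space[OF prob_space_axioms])
  note dist_eq = rokhlin_dist_eq[OF prob_space_axioms]
  show ?thesis
    unfolding mcomplete_def
  proof (intro allI impI)
    fix \<sigma> assume cauchy: "MCauchy \<sigma>"
    then have range: "\<sigma> n \<in> partition_space M l" for n
      by (auto simp: MCauchy_def)
    have "\<exists>N. \<forall>n m. N \<le> n \<longrightarrow> N \<le> m \<longrightarrow> rokhlin_dist M l (\<sigma> n) (\<sigma> m) < (1 / 2) ^ j" for j :: nat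
      using cauchy by (simp add: MCauchy_def)
    then obtain f where f: "\<And>j n m. f j \<le> n \<Longrightarrow> f j \<le> m \<Longrightarrow>
        rokhlin_dist M l (\<sigma> n) (\<sigma> m) < (1 / 2) ^ j"
      by metis
    \<comment> \<open>A strictly increasing sequence of indices that dominates \<open>f\<close>.\<close>
    define r where "r j = (\<Sum>i\<le>j. f i) + j" for j
    have r: "strict_mono r" "f j \<le> r j" for j
    proof -
      show "strict_mono r"
        by (simp add: strict_mono_Suc_iff r_def)
      have "f j \<le> (\<Sum>i\<le>j. f i)"
        by (rule member_le_sum) auto
      then show "f j \<le> r j" by (simp add: r_def)
    qed
    have fast: "rokhlin_dist M l (\<sigma> (r j)) (\<sigma> (r (Suc j))) < (1 / 2) ^ j" for j
      using r(2)[of j] strict_mono_leD[OF r(1), of j "Suc j"] by (intro f) auto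
    have "\<exists>P. \<forall>j. P j \<in> \<sigma> (r j) \<and>
        (\<Sum>i\<in>{1..l}. measure M (sym_diff (P j i) (P (Suc j) i))) < (1 / 2) ^ j"
    proof (rule dependent_nat_choice)
      show "\<exists>P. P \<in> \<sigma> (r 0)"
        using partition_space_representative[OF range] by blast
    next
      fix P j assume P: "P \<in> \<sigma> (r j)"
      obtain Q where Q: "Q \<in> \<sigma> (r (Suc j))"
        using partition_space_representative[OF range] by blast
      have Qe: "Q \<in> enum_partitions M l"
        by (rule partition_space_member[OF range Q])
      obtain \<pi> where \<pi>: "\<pi> permutes {1..l}"
        "enum_dist M l P Q = (\<Sum>i\<in>{1..l}. measure M (sym_diff (P i) (Q (\<pi> i))))"
        by (rule enum_dist_attained)
      have "Q \<circ> \<pi> \<in> \<sigma> (r (Suc j))"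
        using permute_cells(2)[OF Qe \<pi>(1)] Q range[of "r (Suc j)"]
          in_quotient_imp_closed[OF equiv_same_partition[OF prob_space_axioms]]
        unfolding partition_space_def by blast
      moreover have "enum_dist M l P Q < (1 / 2) ^ j"
        using fast[of j] dist_eq[OF range P range Q] by simp
      ultimately show "\<exists>Q. Q \<in> \<sigma> (r (Suc j)) \<and>
          (\<Sum>i\<in>{1..l}. measure M (sym_diff (P i) (Q i))) < (1 / 2) ^ j"
        using \<pi>(2) by (intro exI[of _ "Q \<circ> \<pi>"]) simp
    qed
    then obtain P where P: "\<And>j. P j \<in> \<sigma> (r j)"
      and near: "\<And>j. (\<Sum>i\<in>{1..l}. measure M (sym_diff (P j i) (P (Suc j) i))) < (1 / 2) ^ j"
      by blast
    have Pe: "P j \<in> enum_partitions M l" for j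
      by (rule partition_space_member[OF range P])
    obtain Q where Q: "Q \<in> enum_partitions M l"
        "\<And>n. enum_dist M l (P n) Q \<le> real l * (2 * (1 / 2) ^ n)"
      using eventually_constant_limit[of P l] Pe near by blast
    define q where "q = same_partition M l `` {Q}"
    have q: "q \<in> partition_space M l" "Q \<in> q"
      unfolding q_def using partition_space_class[OF Q(1)] by auto
    have dist: "rokhlin_dist M l (\<sigma> (r n)) q = enum_dist M l (P n) Q" for n
      by (rule dist_eq[OF range P q])
    have "(\<lambda>n. real l * (2 * (1 / 2) ^ n)) \<longlonglongrightarrow> real l * (2 * 0)"
      by (intro tendsto_intros LIMSEQ_realpow_zero) auto
    then have geometric: "(\<lambda>n. real l * (2 * (1 / 2) ^ n)) \<longlonglongrightarrow> 0"
      by simp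
    have "(\<lambda>n. rokhlin_dist M l (\<sigma> (r n)) q) \<longlonglongrightarrow> 0"
      unfolding dist
    proof (rule tendsto_sandwich[OF _ _ tendsto_const geometric])
      show "\<forall>\<^sub>F n in sequentially. 0 \<le> enum_dist M l (P n) Q"
        by (rule always_eventually) (simp add: enum_dist_nonneg)
      show "\<forall>\<^sub>F n in sequentially. enum_dist M l (P n) Q \<le> real l * (2 * (1 / 2) ^ n)"
        by (rule always_eventually) (rule allI, rule Q(2))
    qed
    then have "limitin mtopology (\<sigma> \<circ> r) q sequentially"
      using q(1) range unfolding limitin_metric_dist_null by simp
    then show "\<exists>x. limitin mtopology \<sigma> x sequentially"
      using MCauchy_convergent_subsequence[OF cauchy r(1)] by blast
  qed
qed

end

section \<open>Sets of small positive measure\<close>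

context mp_system
begin

text \<open>
  The preimages of a point of positive measure all have the same measure, so two of them intersect,
  and then the point is periodic.
\<close>

lemma aperiodic_measure_singleton:
  assumes "aperiodic_map M T" and a: "{a} \<in> sets M"
  shows "measure M {a} = 0"
proof (rule ccontr)
  let ?m = "measure M {a}"
  assume "?m \<noteq> 0"
  then have pos: "0 < ?m"
    by (simp add: zero_less_measure_iff)
  define V where "V j = (T ^^ j) -` {a} \<inter> space M" for j
  have V: "V j \<in> sets M" for j
    unfolding V_def using a by measurable
  have mV: "measure M (V j) = ?m" for j
    unfolding V_def by (rule measure_preimage[OF a])
  obtain n where n: "1 < real n * ?m"
    using ex_less_of_nat_mult[OF pos] by blast
  have "\<not> disjoint_family_on V {..<n}"
  proof
    assume "disjoint_family_on V {..<n}"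
    then have "measure M (\<Union>j\<in>{..<n}. V j) = (\<Sum>j<n. measure M (V j))"
      using V by (intro finite_measure_finite_Union) auto
    then have "measure M (\<Union>j\<in>{..<n}. V j) = real n * ?m"
      by (simp add: mV)
    then show False
      using n prob_le_1[of "\<Union>j\<in>{..<n}. V j"] by linarith
  qed
  then obtain i j x where ij: "i < j" "x \<in> V i" "x \<in> V j"
    unfolding disjoint_family_on_def by (metis disjoint_iff linorder_neqE_nat)
  have "(T ^^ (j - i)) a = (T ^^ (j - i)) ((T ^^ i) x)"
    using ij(2) by (simp add: V_def)
  also have "\<dots> = (T ^^ (j - i + i)) x"
    by (simp only: funpow_add o_apply)
  also have "\<dots> = a"
    using ij by (simp add: V_def)
  finally have per: "(T ^^ (j - i)) a = a" .
  obtain N where N: "{x \<in> space M. \<not> (\<forall>n\<ge>1. (T ^^ n) x \<noteq> x)} \<subseteq> N" "emeasure M N = 0" "N \<in> sets M"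
    using assms(1) unfolding aperiodic_map_def by (rule AE_E)
  have "a \<in> N"
    using N(1) per ij(1) sets.sets_into_space[OF a] by (auto intro!: subsetD[OF N(1)] exI[of _ "j - i"])
  then have "?m \<le> measure M N"
    using N(3) by (intro finite_measure_mono) auto
  then show False
    using pos N(2) by (simp add: measure_def)
qed

text \<open>
  The isomorphic measure on the line has no point masses. Hence every real number has a rational
  interval of measure less than \<open>\<delta>\<close> around it; there are countably many of these intervals and they
  cover the line, so one of them has positive measure.
\<close>

lemma aperiodic_small_sets:
  assumes "standard_prob_space M" "aperiodic_map M T" "0 < \<delta>"
  obtains A where "A \<in> sets M" "0 < measure M A" "measure M A < \<delta>"
proof -
  obtain N :: "real measure" where N: "prob_space N" "sets N = sets borel"
    and iso: "isomorphic_mod0 (completion M) (completion N)"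
    using assms(1) by (auto simp: standard_prob_space_def)
  interpret N: prob_space N by (rule N(1))
  have spaceN: "space N = UNIV"
    using N(2) sets_eq_imp_space_eq[of N borel] by simp
  obtain A0 f B where A0: "A0 \<in> sets (completion M)" and B: "B \<in> sets (completion N)"
    "space (completion N) - B \<in> null_sets (completion N)"
    and f: "bij_betw f A0 B"
    "f \<in> measurable (restrict_space (completion M) A0) (restrict_space (completion N) B)"
    and pres: "\<And>C. C \<in> sets (completion N) \<Longrightarrow> C \<subseteq> B \<Longrightarrow>
      emeasure (completion M) (f -` C \<inter> A0) = emeasure (completion N) C"
    using iso unfolding isomorphic_mod0_def by blast
  \<comment> \<open>The isomorphism lives on the completions; the main part brings the preimage back to \<open>sets M\<close>.\<close>
  have transfer: "main_part M (f -` (C \<inter> B) \<inter> A0) \<in> sets M"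
    "main_part M (f -` (C \<inter> B) \<inter> A0) \<subseteq> f -` (C \<inter> B) \<inter> A0"
    "measure M (main_part M (f -` (C \<inter> B) \<inter> A0)) = measure N C" if C: "C \<in> sets N" for C
  proof -
    have CB: "C \<inter> B \<in> sets (completion N)"
      using C B(1) by auto
    have "C \<inter> B \<in> sets (restrict_space (completion N) B)"
      using C B(1) by (subst sets_restrict_space) auto
    then have "f -` (C \<inter> B) \<inter> space (restrict_space (completion M) A0)
        \<in> sets (restrict_space (completion M) A0)"
      by (rule measurable_sets[OF f(2)])
    moreover have "space (restrict_space (completion M) A0) = A0"
      using sets.sets_into_space[OF A0] by (auto simp: space_restrict_space)
    ultimately have pre: "f -` (C \<inter> B) \<inter> A0 \<in> sets (completion M)"
      using sets_restrict_space_iff[OF sets.Int[OF A0 sets.top]] by metis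
    show "main_part M (f -` (C \<inter> B) \<inter> A0) \<in> sets M"
      using pre by simp
    show "main_part M (f -` (C \<inter> B) \<inter> A0) \<subseteq> f -` (C \<inter> B) \<inter> A0"
      using main_part_null_part_Un[OF pre] by blast
    have "emeasure M (main_part M (f -` (C \<inter> B) \<inter> A0)) = emeasure (completion N) (C \<inter> B)"
      using pres[OF CB] emeasure_completion[OF pre] by simp
    also have "\<dots> = emeasure (completion N) C"
    proof -
      have "C \<inter> B = C - (space (completion N) - B)"
        by (auto simp: spaceN)
      then show ?thesis
        using C emeasure_Diff_null_set[OF B(2), of C] by simp
    qed
    also have "\<dots> = emeasure N C"
      using C by simp
    finally show "measure M (main_part M (f -` (C \<inter> B) \<inter> A0)) = measure N C"
      by (simp add: measure_def)
  qed
  have atomless: "measure N {y} = 0" for y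
  proof -
    let ?Y = "main_part M (f -` ({y} \<inter> B) \<inter> A0)"
    have y: "{y} \<in> sets N" by (simp add: N(2))
    have "\<exists>a. f -` ({y} \<inter> B) \<inter> A0 \<subseteq> {a}"
      using f(1) by (auto simp: bij_betw_def inj_on_def)
    then obtain a where "?Y \<subseteq> {a}"
      using transfer(2)[OF y] by blast
    then consider "?Y = {}" | "?Y = {a}" by blast
    then have "measure M ?Y = 0"
    proof cases
      case 2
      then show ?thesis
        using aperiodic_measure_singleton[OF assms(2), of a] transfer(1)[OF y] by simp
    qed simp
    then show ?thesis using transfer(3)[OF y] by simp
  qed
  define I where "I = {(p, q). p \<in> \<rat> \<and> q \<in> \<rat> \<and> measure N {p<..<q} < \<delta>}"
  have "I \<subseteq> \<rat> \<times> \<rat>"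
    by (auto simp: I_def)
  then have "countable I"
    using countable_rat by (meson countable_SIGMA countable_subset)
  have cover: "\<exists>(p, q)\<in>I. y \<in> {p<..<q}" for y
  proof -
    define V where "V n = {y - 1 / real (Suc n)<..<y + 1 / real (Suc n)}" for n
    have "decseq V"
    proof (rule decseq_SucI)
      fix n
      have "1 / real (Suc (Suc n)) \<le> 1 / real (Suc n)"
        by (simp add: frac_le)
      then show "V (Suc n) \<subseteq> V n" by (auto simp: V_def)
    qed
    moreover have "(\<Inter>n. V n) = {y}"
    proof (intro set_eqI iffI)
      fix z assume z: "z \<in> (\<Inter>n. V n)"
      have "\<not> 0 < \<bar>z - y\<bar>"
      proof
        assume "0 < \<bar>z - y\<bar>"
        then obtain n where "1 / real (Suc n) < \<bar>z - y\<bar>"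
          using nat_approx_posE by blast
        moreover have "z \<in> V n" using z by blast
        ultimately show False by (auto simp: V_def)
      qed
      then show "z \<in> {y}" by simp
    qed (auto simp: V_def)
    ultimately have "(\<lambda>n. measure N (V n)) \<longlonglongrightarrow> measure N {y}"
      using N.finite_Lim_measure_decseq[of V] by (auto simp: V_def N(2) image_subset_iff)
    then have "eventually (\<lambda>n. measure N (V n) < \<delta>) sequentially"
      using assms(3) by (auto simp: atomless intro: order_tendstoD)
    then obtain n where n: "measure N (V n) < \<delta>"
      using eventually_happens trivial_limit_sequentially by blast
    obtain p where p: "p \<in> \<rat>" "y - 1 / real (Suc n) < p" "p < y"
      using Rats_dense_in_real[of "y - 1 / real (Suc n)" y] by auto
    obtain q where q: "q \<in> \<rat>" "y < q" "q < y + 1 / real (Suc n)"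
      using Rats_dense_in_real[of y "y + 1 / real (Suc n)"] by auto
    have "measure N {p<..<q} \<le> measure N (V n)"
      using p q by (intro N.finite_measure_mono) (auto simp: V_def N(2))
    then have "(p, q) \<in> I"
      using n p q by (simp add: I_def)
    then show ?thesis
      using p q by auto
  qed
  have "\<exists>(p, q)\<in>I. measure N {p<..<q} \<noteq> 0"
  proof (rule ccontr)
    assume "\<not> ?thesis"
    then have "(\<Union>i\<in>I. {fst i<..<snd i}) \<in> null_sets N"
      by (intro null_sets_UN'[OF \<open>countable I\<close>])
        (auto simp: null_sets_def N(2) N.emeasure_eq_measure)
    moreover have "(\<Union>i\<in>I. {fst i<..<snd i}) = UNIV"
      using cover by fastforce
    ultimately show False
      using N.emeasure_space_1 by (auto simp: spaceN null_sets_def)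
  qed
  then obtain p q where pq: "(p, q) \<in> I" "measure N {p<..<q} \<noteq> 0"
    by auto
  have "{p<..<q} \<in> sets N" by (simp add: N(2))
  from transfer(1,3)[OF this] show thesis
    using pq by (intro that) (auto simp: I_def zero_less_measure_iff)
qed

end

section \<open>A countdown clock with equidistributed residues\<close>

text \<open>
  The time until the orbit reaches \<open>A\<close> runs backwards along orbits, in steps of one until it is zero.
  With \<open>A\<close> small it serves as a substitute for the levels of a Rokhlin tower.
\<close>

definition clock :: "('a \<Rightarrow> 'a) \<Rightarrow> 'a set \<Rightarrow> 'a \<Rightarrow> nat" where
  "clock T A x = (LEAST n. (T ^^ n) x \<in> A)"

lemma clock_funpow:
  assumes "(T ^^ n) x \<in> A" "j \<le> clock T A x"
  shows "clock T A ((T ^^ j) x) = clock T A x - j" "\<exists>n. (T ^^ n) ((T ^^ j) x) \<in> A"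
proof -
  let ?P = "\<lambda>n. (T ^^ n) x \<in> A"
  have hit: "?P (clock T A x)"
    unfolding clock_def by (rule LeastI[of ?P, OF assms(1)])
  have shift: "(T ^^ m) ((T ^^ j) x) = (T ^^ (m + j)) x" for m
    by (simp add: funpow_add)
  show "\<exists>n. (T ^^ n) ((T ^^ j) x) \<in> A"
    using hit assms(2) by (intro exI[of _ "clock T A x - j"]) (simp add: shift)
  show "clock T A ((T ^^ j) x) = clock T A x - j"
    unfolding clock_def[of T A "(T ^^ j) x"]
  proof (rule Least_equality)
    show "(T ^^ (clock T A x - j)) ((T ^^ j) x) \<in> A"
      using hit assms(2) by (simp add: shift)
    show "clock T A x - j \<le> m" if "(T ^^ m) ((T ^^ j) x) \<in> A" for m
    proof -
      have "clock T A x \<le> m + j"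
        using that unfolding shift clock_def by (rule Least_le)
      then show ?thesis by simp
    qed
  qed
qed

context mp_system
begin

text \<open>
  The set of points that visit \<open>A\<close> infinitely often is strictly invariant, and it has measure at least
  \<open>\<mu>(A)\<close> because each set of points that visit \<open>A\<close> after time \<open>m\<close> contains the \<open>m\<close>-th preimage of \<open>A\<close>.
\<close>

lemma ergodic_hits:
  assumes "ergodic_map M T" and A: "A \<in> sets M" "0 < measure M A"
  shows "AE x in M. \<exists>n. (T ^^ n) x \<in> A"
proof -
  have [measurable]: "A \<in> sets M" by fact
  define V where "V m = {x \<in> space M. \<exists>n\<ge>m. (T ^^ n) x \<in> A}" for m
  define G where "G = {x \<in> space M. \<forall>m. \<exists>n\<ge>m. (T ^^ n) x \<in> A}"
  have V [measurable]: "V m \<in> sets M" for m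
    unfolding V_def by measurable
  have G [measurable]: "G \<in> sets M"
    unfolding G_def by measurable
  have "T -` G \<inter> space M = G"
  proof (intro set_eqI iffI)
    fix x assume x: "x \<in> T -` G \<inter> space M"
    have "\<exists>n\<ge>m. (T ^^ n) x \<in> A" for m
    proof -
      obtain n where "n \<ge> m" "(T ^^ n) (T x) \<in> A"
        using x by (auto simp: G_def)
      then show ?thesis
        by (intro exI[of _ "Suc n"]) (simp add: funpow_swap1)
    qed
    then show "x \<in> G" using x by (auto simp: G_def)
  next
    fix x assume x: "x \<in> G"
    then have xM: "x \<in> space M" by (simp add: G_def)
    have "\<exists>n\<ge>m. (T ^^ n) (T x) \<in> A" for m
    proof -
      obtain n where "n \<ge> Suc m" "(T ^^ n) x \<in> A"
        using x by (auto simp: G_def)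
      then show ?thesis
        by (intro exI[of _ "n - 1"]) (cases n; simp add: funpow_swap1)
    qed
    then show "x \<in> T -` G \<inter> space M"
      using xM funpow_space[OF xM, of 1] by (simp add: G_def)
  qed
  then have "measure M G = 0 \<or> measure M G = 1"
    using assms(1) G by (simp add: ergodic_map_def)
  moreover have "measure M A \<le> measure M G"
  proof -
    have "decseq V"
      unfolding decseq_def V_def by (auto intro: order_trans)
    moreover have "(\<Inter>m. V m) = G"
      by (auto simp: V_def G_def)
    ultimately have "(\<lambda>m. measure M (V m)) \<longlonglongrightarrow> measure M G"
      using finite_Lim_measure_decseq[of V] V by (simp add: image_subset_iff)
    moreover have "measure M A \<le> measure M (V m)" for m
    proof -
      have "measure M ((T ^^ m) -` A \<inter> space M) \<le> measure M (V m)"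
        by (rule finite_measure_mono) (auto simp: V_def[abs_def])
      then show ?thesis by (simp add: measure_preimage A)
    qed
    ultimately show ?thesis
      by (intro LIMSEQ_le_const) auto
  qed
  ultimately have "measure M G = 1"
    using A(2) by linarith
  then have "AE x in M. x \<in> G"
    using AE_prob_1 by blast
  then show ?thesis
    by (rule eventually_mono) (auto simp: G_def)
qed

end

locale clocked_system = mp_system +
  fixes A :: "'a set"
  assumes A_sets [measurable]: "A \<in> sets M"
    and hits: "AE x in M. \<exists>n. (T ^^ n) x \<in> A"
begin

abbreviation \<tau> :: "'a \<Rightarrow> nat" where
  "\<tau> \<equiv> clock T A"

lemma clock_measurable [measurable]: "\<tau> \<in> measurable M (count_space UNIV)"
  unfolding clock_def[abs_def] by measurable

text \<open>
  Up to the set \<open>A\<close>, on which the clock is reset, the class of \<open>h + 1\<close> is the preimage of the class of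
  \<open>h\<close>. Hence the measures of the \<open>m\<close> residue classes decrease by at most \<open>\<mu>(A)\<close> at each step, and they
  add up to one.
\<close>

lemma measure_clock_mod:
  assumes "h < m"
  shows "\<bar>measure M {x \<in> space M. \<tau> x mod m = h} - 1 / real m\<bar> \<le> real m * measure M A"
proof -
  define E where "E h = {x \<in> space M. \<tau> x mod m = h}" for h
  let ?\<alpha> = "measure M A" and ?e = "\<lambda>h. measure M (E h)"
  have m: "0 < m" using assms by simp
  have E [measurable]: "E h \<in> sets M" for h
    unfolding E_def by measurable
  have step: "?e (Suc h) \<le> ?e h" "?e h \<le> ?e (Suc h) + ?\<alpha>" if "Suc h < m" for h
  proof -
    have pre: "measure M (T -` E h \<inter> space M) = ?e h"
      using measure_preimage[OF E, of 1] by simp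
    have "AE x in M. x \<in> E (Suc h) \<longrightarrow> x \<in> T -` E h \<inter> space M"
      using hits
    proof (rule AE_mp, intro AE_I2 impI)
      fix x assume x: "x \<in> space M" "\<exists>n. (T ^^ n) x \<in> A" "x \<in> E (Suc h)"
      then have mod: "\<tau> x mod m = Suc h" by (simp add: E_def)
      then have pos: "1 \<le> \<tau> x" by (cases "\<tau> x") auto
      then have "\<tau> (T x) = \<tau> x - 1"
        using x(2) clock_funpow(1)[of _ T x A 1] by auto
      moreover have "(\<tau> x - 1) mod m = h"
        using mod pos by (metis Suc_diff_1 Suc_le_lessD One_nat_def diff_Suc_1 mod_Suc nat.distinct(1))
      ultimately show "x \<in> T -` E h \<inter> space M"
        using x(1) funpow_space[OF x(1), of 1] by (simp add: E_def)
    qed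
    then have "?e (Suc h) \<le> measure M (T -` E h \<inter> space M)"
      by (rule finite_measure_mono_AE) measurable
    then show "?e (Suc h) \<le> ?e h" by (simp add: pre)
    have "AE x in M. x \<in> T -` E h \<inter> space M \<longrightarrow> x \<in> E (Suc h) \<union> A"
      using hits
    proof (rule AE_mp, intro AE_I2 impI)
      fix x assume x: "x \<in> space M" "\<exists>n. (T ^^ n) x \<in> A" "x \<in> T -` E h \<inter> space M"
      show "x \<in> E (Suc h) \<union> A"
      proof (cases "\<tau> x = 0")
        case True
        have "(T ^^ \<tau> x) x \<in> A"
          using x(2) unfolding clock_def by (rule LeastI_ex)
        then show ?thesis using True by simp
      next
        case False
        then have "\<tau> (T x) = \<tau> x - 1"
          using x(2) clock_funpow(1)[of _ T x A 1] by auto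
        then have "(\<tau> x - 1) mod m = h"
          using x(3) by (simp add: E_def)
        then have "\<tau> x mod m = Suc h"
          using False that mod_Suc[of "\<tau> x - 1" m] by simp
        then show ?thesis using x(1) by (simp add: E_def)
      qed
    qed
    then have "measure M (T -` E h \<inter> space M) \<le> measure M (E (Suc h) \<union> A)"
      by (rule finite_measure_mono_AE) measurable
    also have "\<dots> \<le> ?e (Suc h) + ?\<alpha>"
      by (rule measure_Un_le) measurable
    finally show "?e h \<le> ?e (Suc h) + ?\<alpha>" by (simp add: pre)
  qed
  have bounds: "?e h \<le> ?e 0 \<and> ?e 0 \<le> ?e h + real h * ?\<alpha>" if "h < m" for h
    using that
  proof (induction h)
    case (Suc h)
    then show ?case using step[of h] by (simp add: algebra_simps)
  qed simp
  have total: "(\<Sum>h<m. ?e h) = 1"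
  proof -
    have "(\<Sum>h<m. ?e h) = measure M (\<Union>h<m. E h)"
      by (rule finite_measure_finite_Union[symmetric]) (auto simp: E_def disjoint_family_on_def)
    also have "(\<Union>h<m. E h) = space M"
      using m by (auto simp: E_def)
    finally show ?thesis by (simp add: prob_space)
  qed
  have "1 \<le> real m * ?e 0"
    using sum_mono[of "{..<m}" ?e "\<lambda>_. ?e 0"] bounds total by simp
  then have lo: "1 / real m \<le> ?e 0"
    using m by (simp add: field_simps)
  have near: "?e 0 \<le> ?e h + real m * ?\<alpha>" if "h < m" for h
  proof -
    have "real h * ?\<alpha> \<le> real m * ?\<alpha>"
      using that by (intro mult_right_mono) auto
    then show ?thesis using bounds[OF that] by linarith
  qed
  have "real m * ?e 0 \<le> 1 + real m * (real m * ?\<alpha>)"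
    using sum_mono[of "{..<m}" "\<lambda>_. ?e 0" "\<lambda>h. ?e h + real m * ?\<alpha>"] near
    by (simp add: sum.distrib total)
  then have "real m * ?e 0 \<le> real m * (1 / real m + real m * ?\<alpha>)"
    using m by (simp add: distrib_left)
  then have hi: "?e 0 \<le> 1 / real m + real m * ?\<alpha>"
    using m by (simp add: mult_le_cancel_left)
  show ?thesis
    using bounds[OF assms] near[OF assms] lo hi unfolding E_def by linarith
qed

lemma measure_clock_residues:
  assumes "Z \<subseteq> {..<m}"
  shows "\<bar>measure M {x \<in> space M. \<tau> x mod m \<in> Z} - real (card Z) / real m\<bar>
    \<le> (real m)\<^sup>2 * measure M A"
proof -
  have fin: "finite Z"
    using assms finite_subset by blast
  define E where "E h = {x \<in> space M. \<tau> x mod m = h}" for h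
  have E [measurable]: "E h \<in> sets M" for h
    unfolding E_def by measurable
  have "measure M {x \<in> space M. \<tau> x mod m \<in> Z} = measure M (\<Union>h\<in>Z. E h)"
    by (rule arg_cong[where f = "measure M"]) (auto simp: E_def)
  also have "\<dots> = (\<Sum>h\<in>Z. measure M (E h))"
    using fin by (intro finite_measure_finite_Union) (auto simp: E_def disjoint_family_on_def)
  finally have eq: "measure M {x \<in> space M. \<tau> x mod m \<in> Z} - real (card Z) / real m
      = (\<Sum>h\<in>Z. measure M (E h) - 1 / real m)"
    by (simp add: sum_subtractf)
  have "\<bar>\<Sum>h\<in>Z. measure M (E h) - 1 / real m\<bar> \<le> (\<Sum>h\<in>Z. \<bar>measure M (E h) - 1 / real m\<bar>)"
    by (rule sum_abs)
  also have "\<dots> \<le> (\<Sum>h\<in>Z. real m * measure M A)"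
    using measure_clock_mod assms by (intro sum_mono) (auto simp: E_def)
  also have "\<dots> \<le> real m * (real m * measure M A)"
    using card_mono[OF _ assms] by (auto intro!: mult_right_mono)
  finally show ?thesis
    unfolding eq by (simp add: power2_eq_square mult.assoc)
qed

end

section \<open>Words that reveal their epoch\<close>

text \<open>
  The word is the concatenation of all words of length at most \<open>L\<close>. They are reversed because the clock
  counts down: reading \<open>g\<close> at \<open>v\<close>, \<open>v - 1\<close>, ... yields \<open>B\<close>. A final letter 1 makes the period positive.
\<close>

lemma universal_periodic_word:
  assumes "1 \<le> l"
  obtains W :: nat and g :: "nat \<Rightarrow> nat" where "0 < W" "\<And>t. g t \<in> {1..l}" "\<And>t. g (t mod W) = g t"
    "\<And>n B. n \<le> L \<Longrightarrow> B \<in> blocks l n \<Longrightarrow>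
      \<exists>v<W. n \<le> v + 1 \<and> (\<forall>j<n. g (v - j) = B ! j)"
proof -
  have "finite (\<Union>n\<in>{..L}. blocks l n)"
    by (simp add: finite_blocks)
  then obtain bs where bs: "set bs = (\<Union>n\<in>{..L}. blocks l n)"
    using finite_list by blast
  define w where "w = concat (map rev bs) @ [1]"
  define W where "W = length w"
  define g where "g t = w ! (t mod W)" for t
  have W: "0 < W"
    by (simp add: W_def w_def)
  have letters: "set w \<subseteq> {1..l}"
    using bs assms by (auto simp: w_def blocks_def)
  show thesis
  proof (rule that[of W g])
    show "0 < W" by fact
    show "g t \<in> {1..l}" for t
    proof -
      have "w ! (t mod W) \<in> set w"
        using W unfolding W_def by (intro nth_mem mod_less_divisor)
      then show ?thesis using letters by (auto simp: g_def)
    qed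
    show "g (t mod W) = g t" for t
      by (simp add: g_def)
  next
    fix n B assume n: "n \<le> L" and B: "B \<in> blocks l n"
    have len: "length B = n"
      using B by (simp add: blocks_def)
    have "B \<in> set bs"
      using n B bs by auto
    then obtain xs ys where "bs = xs @ B # ys"
      by (meson split_list)
    then obtain p q where w: "w = p @ rev B @ q"
      by (simp add: w_def)
    show "\<exists>v<W. n \<le> v + 1 \<and> (\<forall>j<n. g (v - j) = B ! j)"
    proof (cases "n = 0")
      case True
      then show ?thesis using W by auto
    next
      case False
      have lt: "length p + n - 1 < W"
        using False len by (simp add: W_def w)
      have "g (length p + n - 1 - j) = B ! j" if "j < n" for j
      proof -
        have "length p + n - 1 - j = length p + (n - Suc j)"
          using that by simp
        moreover have "length p + (n - Suc j) < W"
          using that lt by linarith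
        ultimately show ?thesis
          using that len by (simp add: g_def w nth_append rev_nth del: Nat.add_diff_assoc)
      qed
      then show ?thesis
        using lt False by (intro exI[of _ "length p + n - 1"]) auto
    qed
  qed
qed

text \<open>
  The longest run of the letter 1, measured in multiples of \<open>b\<close>, is the mark by which a word reveals
  the epoch in which it was written.
\<close>

definition has_run :: "nat list \<Rightarrow> nat \<Rightarrow> bool" where
  "has_run B L \<longleftrightarrow> (\<exists>s. s + L \<le> length B \<and> (\<forall>j<L. B ! (s + j) = 1))"

definition run_type :: "nat \<Rightarrow> nat list \<Rightarrow> nat \<Rightarrow> bool" where
  "run_type b B i \<longleftrightarrow> has_run B (i * b) \<and> \<not> has_run B ((i + 1) * b)"

lemma has_run_mono:
  assumes "has_run B L" "L' \<le> L"
  shows "has_run B L'"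
proof -
  obtain s where "s + L \<le> length B" "\<forall>j<L. B ! (s + j) = 1"
    using assms(1) by (auto simp: has_run_def)
  then show ?thesis
    using assms(2) unfolding has_run_def by (intro exI[of _ s]) auto
qed

lemma run_type_unique:
  assumes "run_type b B i" "run_type b B j"
  shows "i = j"
proof -
  have "\<not> i < j" if "run_type b B i" "run_type b B j" for i j
  proof
    assume "i < j"
    then have "(i + 1) * b \<le> j * b"
      by (intro mult_right_mono) auto
    then show False
      using that has_run_mono by (auto simp: run_type_def)
  qed
  then show ?thesis
    using assms by (meson linorder_neqE_nat)
qed

text \<open>
  The clock value \<open>t\<close> lies in the epoch \<open>e\<close>, where epochs have length \<open>S\<close> and are numbered cyclically by
  \<open>0..R-1\<close>; \<open>a\<close> is the letter of the given colouring. Epoch 0 is filled with the periodic word \<open>g\<close>. In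
  an epoch \<open>e > 0\<close> time is divided into cells of length \<open>b\<close>, of which \<open>e\<close> consecutive ones out of \<open>D\<close>
  are filled with the letter 1. The remaining cells start with a 2, which keeps all other runs short,
  and otherwise keep the given letters.
\<close>

definition clock_letter ::
    "(nat \<Rightarrow> nat) \<Rightarrow> nat \<Rightarrow> nat \<Rightarrow> nat \<Rightarrow> nat \<Rightarrow> nat \<Rightarrow> nat \<Rightarrow> nat" where
  "clock_letter g R S b D t a =
    (let e = (t div S) mod R in
      if e = 0 then g t
      else if (t div b) mod D \<in> {1..e} then 1
      else if t mod b = 0 then 2
      else a)"

text \<open>
  A word of length at least \<open>2 * b * D\<close> written inside epoch \<open>e\<close> contains all \<open>e\<close> filled cells of some
  group, a run of length \<open>e * b\<close>. A window of length \<open>(e + 1) * b\<close> contains the beginnings of \<open>e + 1\<close>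
  consecutive cells, and one of these cells is not filled, so it contributes a 2.
\<close>

lemma clock_letter_run_type:
  assumes "0 < b" and R: "0 < R" "R \<le> D" and e: "e = (t div S) mod R" "1 \<le> e"
    and n: "length B = n" "2 * b * D \<le> n" "n \<le> t mod S"
    and B: "\<And>j. j < n \<Longrightarrow> B ! j = clock_letter g R S b D (t - j) (a j)"
  shows "run_type b B e"
proof -
  have S: "0 < S" and eD: "e + 1 \<le> D" and D: "0 < D"
  proof -
    show "0 < S"
    proof (rule ccontr)
      assume "\<not> 0 < S"
      then show False using e by simp
    qed
    have "e < R" using e R(1) by simp
    then show "e + 1 \<le> D" "0 < D" using R by simp_all
  qed
  have ep: "((t - j) div S) mod R = e" if "j < n" for j
  proof -
    have "t - j = (t mod S - j) + S * (t div S)"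
      using that n(3) mult_div_mod_eq[of S t] by linarith
    then have "(t - j) div S = (t mod S - j) div S + t div S"
      using S by simp
    moreover have "t mod S - j < S"
      using S by (meson less_imp_diff_less mod_less_divisor)
    ultimately have "(t - j) div S = t div S"
      by simp
    then show ?thesis using e by simp
  qed
  have letter: "B ! j = (if ((t - j) div b) mod D \<in> {1..e} then 1
      else if (t - j) mod b = 0 then 2 else a j)" if "j < n" for j
    using B[OF that] ep[OF that] e(2) by (simp add: clock_letter_def Let_def)
  have tn: "n \<le> t"
    using n(3) by (meson mod_less_eq_dividend order_trans)
  show ?thesis
    unfolding run_type_def
  proof
    \<comment> \<open>The last group of cells completely before \<open>t\<close>; its filled cells end at \<open>u\<close>.\<close>
    define m where "m = t div (b * D) - 1"
    have bD: "0 < b * D" using assms D by simp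
    have "2 * (b * D) \<le> t" using n(2) tn by (simp add: mult.assoc)
    then have "2 \<le> t div (b * D)"
      using bD by (metis div_le_mono nonzero_mult_div_cancel_right less_irrefl)
    then have tm: "t div (b * D) = m + 1"
      by (simp add: m_def)
    have t1: "b * D * m + b * D \<le> t"
      using mult_div_mod_eq[of "b * D" t] tm by (metis add.right_neutral distrib_left le_add1 mult.right_neutral)
    have t2: "t < b * D * m + 2 * b * D"
      using mult_div_mod_eq[of "b * D" t] mod_less_divisor[OF bD, of t] tm
      by (simp add: algebra_simps)
    have be: "b * (e + 1) \<le> b * D" using eD by (rule mult_le_mono2)
    define u where "u = b * D * m + b * (e + 1) - 1"
    have u: "u + 1 = b * D * m + b * (e + 1)"
      using assms(1) by (simp add: u_def)
    have ut: "u < t"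
      using u t1 be by linarith
    have one: "B ! (t - u + j) = 1" if j: "j < e * b" for j
    proof -
      define v where "v = b * (e + 1) - 1 - j"
      have be': "b * (e + 1) = e * b + b" by (simp add: algebra_simps)
      have v: "b \<le> v" "v < b * (e + 1)" "t - (t - u + j) = b * (D * m) + v"
        using j u ut assms(1) be' unfolding v_def by (auto simp: u_def algebra_simps)
      have "v div b \<le> e"
        using v(2) by (metis Suc_eq_plus1 less_Suc_eq_le less_mult_imp_div_less mult.commute)
      moreover have "1 \<le> v div b"
        using v(1) assms(1) by (simp add: Suc_leI div_greater_zero_iff)
      moreover have "((t - (t - u + j)) div b) mod D = v div b"
        unfolding v(3) using assms(1) eD \<open>v div b \<le> e\<close> by simp
      moreover have "t - u + j < n"
      proof -
        have "e * b + b \<le> b * D" using be unfolding be' .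
        then show ?thesis
          using j t2 u ut n(2) be' by (simp add: mult.assoc mult.commute[of e])
      qed
      ultimately show ?thesis
        using letter[of "t - u + j"] by simp
    qed
    have "t - u + e * b \<le> n"
    proof -
      have "t + e * b + 1 \<le> 2 * b * D + u + 1"
        using u t2 assms(1) by (simp add: algebra_simps)
      then show ?thesis using n(2) ut by linarith
    qed
    then show "has_run B (e * b)"
      unfolding has_run_def using one n(1) by blast
  next
    show "\<not> has_run B ((e + 1) * b)"
    proof
      assume "has_run B ((e + 1) * b)"
      then obtain s where s: "s + (e + 1) * b \<le> n" "\<And>j. j < (e + 1) * b \<Longrightarrow> B ! (s + j) = 1"
        using n(1) by (auto simp: has_run_def)
      \<comment> \<open>The smallest clock value in the run; \<open>q\<close> is the first cell that begins in the run.\<close>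
      define y where "y = t - s - (e + 1) * b + 1"
      define q where "q = (y + b - 1) div b"
      have y: "y + s + (e + 1) * b = t + 1"
        using s(1) tn by (simp add: y_def)
      have "b * q + (y + b - 1) mod b = y + b - 1"
        unfolding q_def by (rule mult_div_mod_eq)
      then have q: "y \<le> b * q" "b * q + 1 \<le> y + b"
        using mod_less_divisor[OF assms(1), of "y + b - 1"] assms(1) by linarith+
      obtain i where i: "i \<le> e" "(q + i) mod D \<notin> {1..e}"
      proof (cases "q mod D \<in> {1..e}")
        case False
        then show ?thesis using that[of 0] by simp
      next
        case True
        define i where "i = e + 1 - q mod D"
        have "(q + i) mod D = (q mod D + i) mod D"
          by (simp add: mod_add_left_eq)
        also have "q mod D + i = e + 1"
          using True by (simp add: i_def)
        finally have "(q + i) mod D = (e + 1) mod D" .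
        moreover have "(e + 1) mod D \<notin> {1..e}"
          using eD by (cases "e + 1 = D") auto
        moreover have "i \<le> e" using True by (auto simp: i_def)
        ultimately show ?thesis using that[of i] by simp
      qed
      have bi: "b * i \<le> b * e" using i(1) by (rule mult_le_mono2)
      have eb: "(e + 1) * b = b * e + b" by (simp add: algebra_simps)
      have qi: "y \<le> b * (q + i)" "b * (q + i) + s \<le> t"
        using q y bi distrib_left[of b q i] eb by linarith+
      define j where "j = t - s - b * (q + i)"
      have j: "j < (e + 1) * b" "t - (s + j) = b * (q + i)" "s + j < n"
        using qi y s(1) assms(1) unfolding j_def by linarith+
      have "B ! (s + j) = 2"
        using letter[OF j(3)] i(2) assms(1) unfolding j(2) by simp
      then show False using s(2)[OF j(1)] by simp
    qed
  qed
qed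

section \<open>Recolouring a partition by the clock\<close>

lemma mod_mult_sub_cell:
  fixes t :: nat
  assumes "0 < b"
  shows "(t div b) mod D = (t mod (b * D)) div b"
  using assms by (simp add: mod_mult2_eq)

context clocked_system
begin

lemma measure_clock_le:
  assumes "Z \<subseteq> {..<m}" "\<And>t. Q t \<Longrightarrow> t mod m \<in> Z"
  shows "measure M {x \<in> space M. Q (\<tau> x)} \<le> real (card Z) / real m + (real m)\<^sup>2 * measure M A"
proof -
  have "measure M {x \<in> space M. Q (\<tau> x)} \<le> measure M {x \<in> space M. \<tau> x mod m \<in> Z}"
    using assms(2) by (intro finite_measure_mono) auto
  then show ?thesis
    using measure_clock_residues[OF assms(1)] by linarith
qed

lemma measure_epoch_le:
  assumes "0 < R" "0 < S" "e < R"
  shows "measure M {x \<in> space M. (\<tau> x div S) mod R = e}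
    \<le> 1 / real R + (real (S * R))\<^sup>2 * measure M A"
proof -
  have sub: "{S * e..<S * e + S} \<subseteq> {..<S * R}"
  proof -
    have "S * e + S = S * (e + 1)" by simp
    also have "\<dots> \<le> S * R" using assms(3) by (intro mult_le_mono2) simp
    finally show ?thesis by auto
  qed
  have "t mod (S * R) \<in> {S * e..<S * e + S}" if "(t div S) mod R = e" for t
    using that assms mod_less_divisor[of S t] by (simp add: mod_mult2_eq)
  from measure_clock_le[OF sub this] show ?thesis
    using assms by simp
qed

lemma measure_small_residues_le:
  assumes "0 < m" "L \<le> m"
  shows "measure M {x \<in> space M. \<tau> x mod m < L} \<le> real L / real m + (real m)\<^sup>2 * measure M A"
  using measure_clock_le[of "{..<L}" m "\<lambda>t. t mod m < L"] assms by auto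

lemma measure_run_cells_le:
  assumes "0 < b" "0 < R" "R \<le> D"
  shows "measure M {x \<in> space M. (\<tau> x div b) mod D \<in> {1..<R}}
    \<le> real R / real D + (real (b * D))\<^sup>2 * measure M A"
proof -
  have sub: "{..<b * R} \<subseteq> {..<b * D}"
    using assms by auto
  have "t mod (b * D) \<in> {..<b * R}" if "(t div b) mod D \<in> {1..<R}" for t
  proof -
    have "(t mod (b * D)) div b < R"
      using that assms(1) by (simp add: mod_mult_sub_cell)
    then show ?thesis
      using assms(1) by (simp add: div_less_iff_less_mult mult.commute)
  qed
  from measure_clock_le[OF sub this] show ?thesis
    using assms by simp
qed

text \<open>
  In an epoch of \<open>s\<close> periods of the word of length \<open>W\<close>, a given place of the word comes up \<open>s\<close> times. The
  bound \<open>1 / (W * R)\<close> depends on the number of epochs but not on their length \<open>W * s\<close>; this is what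
  permits the length to be chosen after the waiting time.
\<close>

lemma measure_word_place_ge:
  assumes "0 < W" "0 < s" "0 < R" "v < W"
  shows "1 / real (W * R) - (real (W * s * R))\<^sup>2 * measure M A
    \<le> measure M {x \<in> space M. (\<tau> x div (W * s)) mod R = 0 \<and> \<tau> x mod W = v}"
proof -
  define Z where "Z = (\<lambda>q. W * q + v) ` {..<s}"
  have card: "card Z = s"
    using assms(1) unfolding Z_def by (subst card_image) (auto simp: inj_on_def)
  have bound: "W * q + v < W * s" if "q < s" for q
  proof -
    have "W * q + v < W * (q + 1)" using assms(4) by simp
    also have "\<dots> \<le> W * s" using that by (intro mult_le_mono2) simp
    finally show ?thesis .
  qed
  have le: "W * s \<le> W * s * R" using assms(3) by simp
  have sub: "Z \<subseteq> {..<W * s * R}"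
    using order_less_le_trans[OF bound le] by (auto simp: Z_def)
  have "(t div (W * s)) mod R = 0 \<and> t mod W = v" if t: "t mod (W * s * R) \<in> Z" for t
  proof -
    obtain q where q: "q < s" "t mod (W * s * R) = W * q + v"
      using t by (auto simp: Z_def)
    have "(t div (W * s)) mod R = (W * q + v) div (W * s)"
      using mod_mult_sub_cell[of "W * s" t R] assms q(2) by simp
    then have "(t div (W * s)) mod R = 0"
      using bound[OF q(1)] by simp
    moreover have "t mod W = t mod (W * s * R) mod W"
      by (simp add: mod_mod_cancel)
    ultimately show ?thesis
      using q(2) assms(4) by simp
  qed
  then have le_place: "measure M {x \<in> space M. \<tau> x mod (W * s * R) \<in> Z}
      \<le> measure M {x \<in> space M. (\<tau> x div (W * s)) mod R = 0 \<and> \<tau> x mod W = v}"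
    by (intro finite_measure_mono) auto
  have frac: "real (card Z) / real (W * s * R) = 1 / real (W * R)"
    using assms by (simp add: card)
  have "1 / real (W * R) - (real (W * s * R))\<^sup>2 * measure M A
      \<le> measure M {x \<in> space M. \<tau> x mod (W * s * R) \<in> Z}"
    using measure_clock_residues[OF sub] unfolding frac abs_diff_le_iff by blast
  then show ?thesis using le_place by (rule order_trans)
qed

context
  fixes c :: "'a \<Rightarrow> nat" and g :: "nat \<Rightarrow> nat" and R S b D :: nat
  assumes c_measurable [measurable]: "c \<in> measurable M (count_space UNIV)"
    and pos: "0 < R" "0 < S" "0 < b" and RD: "R \<le> D"
begin

definition recolour :: "'a \<Rightarrow> nat" where
  "recolour x = clock_letter g R S b D (\<tau> x) (c x)"

lemma recolour_measurable [measurable]: "recolour \<in> measurable M (count_space UNIV)"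
  unfolding recolour_def[abs_def]
  by (rule measurable_compose_countable[OF _ clock_measurable])
    (rule measurable_compose[OF c_measurable measurable_count_space])

text \<open>
  The colouring changes in epoch 0, at the beginnings of cells and in the filled cells, which have
  small densities \<open>1 / R\<close>, \<open>1 / b\<close> and at most \<open>R / D\<close>.
\<close>

lemma measure_recolour_differ:
  "measure M {x \<in> space M. recolour x \<noteq> c x}
    \<le> 1 / real R + 1 / real b + real R / real D
      + ((real (S * R))\<^sup>2 + (real b)\<^sup>2 + (real (b * D))\<^sup>2) * measure M A"
proof -
  let ?U0 = "{x \<in> space M. (\<tau> x div S) mod R = 0}"
  let ?U1 = "{x \<in> space M. \<tau> x mod b < 1}"
  let ?U2 = "{x \<in> space M. (\<tau> x div b) mod D \<in> {1..<R}}"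
  have "{x \<in> space M. recolour x \<noteq> c x} \<subseteq> (?U0 \<union> ?U1) \<union> ?U2"
  proof
    fix x assume x: "x \<in> {x \<in> space M. recolour x \<noteq> c x}"
    have "(\<tau> x div S) mod R < R" using pos by simp
    then show "x \<in> (?U0 \<union> ?U1) \<union> ?U2"
      using x by (auto simp: recolour_def clock_letter_def Let_def split: if_splits)
  qed
  then have "measure M {x \<in> space M. recolour x \<noteq> c x} \<le> measure M ((?U0 \<union> ?U1) \<union> ?U2)"
    by (intro finite_measure_mono) measurable
  also have "\<dots> \<le> measure M (?U0 \<union> ?U1) + measure M ?U2"
    by (rule measure_Un_le) measurable
  also have "measure M (?U0 \<union> ?U1) \<le> measure M ?U0 + measure M ?U1"
    by (rule measure_Un_le) measurable
  finally show ?thesis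
    using measure_epoch_le[of R S 0] measure_small_residues_le[of b 1]
      measure_run_cells_le[of b R D] pos RD by (simp add: algebra_simps)
qed

lemma recolour_funpow:
  assumes "(T ^^ n) x \<in> A" "j \<le> \<tau> x"
  shows "recolour ((T ^^ j) x) = clock_letter g R S b D (\<tau> x - j) (c ((T ^^ j) x))"
  by (simp add: recolour_def clock_funpow(1)[OF assms])

text \<open>
  Epoch 0 alone makes every word of the list appear with a definite frequency.
\<close>

lemma measure_spells_recolour_ge:
  assumes S: "S = W * s" and g: "\<And>t. g (t mod W) = g t"
    and v: "v < W" "length B \<le> v + 1" "\<And>j. j < length B \<Longrightarrow> g (v - j) = B ! j"
  shows "1 / real (W * R) - (real (S * R))\<^sup>2 * measure M A \<le> measure M (spells M T recolour B)"
proof -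
  have W: "0 < W" "0 < s"
    using pos(2) S by simp_all
  let ?U = "{x \<in> space M. (\<tau> x div (W * s)) mod R = 0 \<and> \<tau> x mod W = v}"
  have "AE x in M. x \<in> ?U \<longrightarrow> x \<in> spells M T recolour B"
    using hits
  proof (rule AE_mp, intro AE_I2 impI)
    fix x assume x: "x \<in> space M" "\<exists>n. (T ^^ n) x \<in> A" "x \<in> ?U"
    then obtain n where n: "(T ^^ n) x \<in> A" by blast
    have t: "\<tau> x = W * (\<tau> x div W) + v"
      using x(3) mult_div_mod_eq[of W "\<tau> x"] by simp
    have "recolour ((T ^^ j) x) = B ! j" if j: "j < length B" for j
    proof -
      have jv: "j \<le> v" using j v(2) by simp
      have tj: "\<tau> x - j = (v - j) + W * (\<tau> x div W)"
        using jv t by simp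
      have vj: "v - j < W" using v(1) by simp
      have "(\<tau> x - j) div W = \<tau> x div W"
        unfolding tj using vj W by simp
      then have "((\<tau> x - j) div S) mod R = 0"
        using x(3) by (simp add: S div_mult2_eq)
      moreover have "(\<tau> x - j) mod W = v - j"
        unfolding tj using vj by simp
      then have "g (\<tau> x - j) = g (v - j)"
        by (metis g)
      moreover have "j \<le> \<tau> x" using jv t by linarith
      ultimately show ?thesis
        using recolour_funpow[OF n, of j] v(3)[OF j] by (simp add: clock_letter_def)
    qed
    then show "x \<in> spells M T recolour B"
      using x(1) by (simp add: spells_def)
  qed
  then have "measure M ?U \<le> measure M (spells M T recolour B)"
    by (rule finite_measure_mono_AE) measurable
  then show ?thesis
    using measure_word_place_ge[OF W pos(1) v(1)] by (simp add: S)
qed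

text \<open>
  Outside epoch 0 a long word determines its epoch \<open>i\<close> by its run type. A point of another epoch with at
  least \<open>K\<close> time units left in it cannot meet the word up to time \<open>J\<close>, since its orbit does not leave the
  epoch before that. So the points that meet the word lie in two epochs out of \<open>R\<close> or near the end of an
  epoch.
\<close>

lemma measure_meets_recolour_le:
  assumes n: "2 * b * D \<le> length B" "J + length B \<le> K" "K \<le> S"
  shows "measure M (meets M T J (spells M T recolour B))
    \<le> 2 / real R + real K / real S + (2 * (real (S * R))\<^sup>2 + (real S)\<^sup>2) * measure M A"
proof -
  \<comment> \<open>If no epoch matches the run type of \<open>B\<close>, any \<open>i\<close> will do.\<close>
  obtain i where i: "i < R" "\<And>e. e < R \<Longrightarrow> run_type b B e \<Longrightarrow> e = i"
    using run_type_unique pos(1) by metis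
  let ?U0 = "{x \<in> space M. (\<tau> x div S) mod R = 0}"
  let ?U1 = "{x \<in> space M. (\<tau> x div S) mod R = i}"
  let ?U2 = "{x \<in> space M. \<tau> x mod S < K}"
  have "AE x in M. x \<in> meets M T J (spells M T recolour B) \<longrightarrow> x \<in> (?U0 \<union> ?U1) \<union> ?U2"
    using hits
  proof (rule AE_mp, intro AE_I2 impI)
    fix x assume x: "x \<in> space M" "\<exists>n. (T ^^ n) x \<in> A" "x \<in> meets M T J (spells M T recolour B)"
    then obtain m where m: "(T ^^ m) x \<in> A" by blast
    show "x \<in> (?U0 \<union> ?U1) \<union> ?U2"
    proof (rule ccontr)
      assume "x \<notin> (?U0 \<union> ?U1) \<union> ?U2"
      then have e: "(\<tau> x div S) mod R \<noteq> 0" "(\<tau> x div S) mod R \<noteq> i" and room: "K \<le> \<tau> x mod S"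
        using x(1) by auto
      obtain j where j: "j \<le> J" "(T ^^ j) x \<in> spells M T recolour B"
        using x(3) by (auto simp: meets_def)
      define t where "t = \<tau> x - j"
      have "\<tau> x mod S \<le> \<tau> x" by simp
      then have small: "j + length B \<le> \<tau> x" "j + length B \<le> \<tau> x mod S"
        using room n(2) j(1) by linarith+
      have "t = (\<tau> x mod S - j) + S * (\<tau> x div S)"
        using small mult_div_mod_eq[of S "\<tau> x"] unfolding t_def by linarith
      moreover have "\<tau> x mod S - j < S"
        using pos(2) by (meson less_imp_diff_less mod_less_divisor)
      ultimately have t: "t div S = \<tau> x div S" "t mod S = \<tau> x mod S - j"
        using pos(2) by simp_all
      have letters: "B ! h = clock_letter g R S b D (t - h) (c ((T ^^ (h + j)) x))"
        if "h < length B" for h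
      proof -
        have "B ! h = recolour ((T ^^ (h + j)) x)"
          using j(2) that by (simp add: spells_def funpow_add)
        also have "\<dots> = clock_letter g R S b D (\<tau> x - (h + j)) (c ((T ^^ (h + j)) x))"
          using small that by (intro recolour_funpow[OF m]) simp
        finally show ?thesis by (simp add: t_def add.commute)
      qed
      have "run_type b B ((t div S) mod R)"
        using clock_letter_run_type[OF pos(3,1) RD refl _ refl n(1) _ letters]
          e(1) small(2) t by simp
      then show False
        using i(2) e(2) pos(1) t(1) by simp
    qed
  qed
  then have "measure M (meets M T J (spells M T recolour B)) \<le> measure M ((?U0 \<union> ?U1) \<union> ?U2)"
    by (rule finite_measure_mono_AE) measurable
  also have "\<dots> \<le> measure M (?U0 \<union> ?U1) + measure M ?U2"
    by (rule measure_Un_le) measurable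
  also have "measure M (?U0 \<union> ?U1) \<le> measure M ?U0 + measure M ?U1"
    by (rule measure_Un_le) measurable
  finally show ?thesis
    using measure_epoch_le[of R S 0] measure_epoch_le[of R S i] measure_small_residues_le[of S K]
      pos i(1) n(3) by (simp add: algebra_simps)
qed

end

end

lemma ex_nat_reciprocal_le:
  assumes "0 < (\<epsilon>::real)"
  obtains n :: nat where "0 < n" "1 / real n \<le> \<epsilon>"
proof -
  obtain n where "0 < n" "inverse (real n) < \<epsilon>"
    using ex_inverse_of_nat_less[OF assms] by blast
  then show ?thesis
    using that by (simp add: inverse_eq_divide)
qed

context mp_system
begin

text \<open>
  The parameters are chosen in the order \<open>R\<close>, \<open>b\<close>, \<open>D\<close>, \<open>N\<close>, \<open>W\<close>, \<open>J\<close>, \<open>S\<close>, \<open>A\<close>. The value of \<open>J\<close> comes from the lower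
  bound \<open>1 / (2 * W * R)\<close> for the measure of every word; since this bound does not involve \<open>S\<close>, the epochs
  can be made so long that \<open>J\<close> is negligible compared with their length.
\<close>

lemma clustered_dense:
  assumes "standard_prob_space M" "ergodic_map M T" "aperiodic_map M T" "2 \<le> l"
    and c: "c \<in> measurable M (count_space UNIV)" "\<And>x. x \<in> space M \<Longrightarrow> c x \<in> {1..l}"
    and k: "1 \<le> k" and \<epsilon>: "0 < \<epsilon>"
  obtains c' N J where "c' \<in> measurable M (count_space UNIV)"
    "\<And>x. x \<in> space M \<Longrightarrow> c' x \<in> {1..l}"
    "measure M {x \<in> space M. c' x \<noteq> c x} < \<epsilon>" "k \<le> N" "clustered M T l c' k N J"
proof -
  \<comment> \<open>Room for three summands of size at most \<open>\<eta>\<close> and one error term in each of the two estimates.\<close>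
  define \<eta> where "\<eta> = min (\<epsilon> / 8) (1 / (8 * (real k)\<^sup>2))"
  have \<eta>: "0 < \<eta>" "8 * \<eta> \<le> \<epsilon>" "8 * \<eta> \<le> 1 / (real k)\<^sup>2"
    using k \<epsilon> by (auto simp: \<eta>_def min_def field_simps)
  obtain R where R: "0 < R" "1 / real R \<le> \<eta>"
    using ex_nat_reciprocal_le[OF \<eta>(1)] by blast
  define b where "b = R"
  obtain d where d: "0 < d" "1 / real d \<le> \<eta>"
    using ex_nat_reciprocal_le[OF \<eta>(1)] by blast
  define D where "D = R * d"
  have D: "R \<le> D" "real R / real D \<le> \<eta>"
    using R(1) d by (simp_all add: D_def)
  define N where "N = 2 * b * D * k"
  have N: "2 * b * D \<le> N" "k \<le> N"
    using k R(1) d(1) by (simp_all add: N_def b_def D_def)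
  obtain W g where W: "0 < W" "\<And>t. g t \<in> {1..l}" "\<And>t. g (t mod W) = g t"
    and place: "\<And>n B. n \<le> k * N \<Longrightarrow> B \<in> blocks l n \<Longrightarrow>
      \<exists>v<W. n \<le> v + 1 \<and> (\<forall>j<n. g (v - j) = B ! j)"
    using universal_periodic_word[of l "k * N"] assms(4) by auto
  define J where "J = 2 * k * W * R"
  define K where "K = J + k * N"
  define s where "s = (K + 1) * d"
  define S where "S = W * s"
  have S: "0 < S" "K \<le> S" "real K / real S \<le> \<eta>"
  proof -
    have "(K + 1) * d \<le> S"
      using W(1) by (simp add: S_def s_def)
    moreover have "(K + 1) * 1 \<le> (K + 1) * d" using d(1) by (intro mult_le_mono2) simp
    ultimately have "(K + 1) * 1 \<le> S" by (rule order_trans[rotated])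
    then show "0 < S" "K \<le> S" by simp_all
    have "real K * real d \<le> real S"
      using \<open>(K + 1) * d \<le> S\<close> by (simp add: algebra_simps flip: of_nat_mult)
    then have "real K / real S \<le> 1 / real d"
      using \<open>0 < S\<close> d(1) by (simp add: field_simps)
    then show "real K / real S \<le> \<eta>" using d(2) by linarith
  qed
  \<comment> \<open>\<open>2 * \<Theta> * \<mu>(A)\<close> dominates the error terms of all estimates for residue classes of the clock.\<close>
  define \<Theta> where "\<Theta> = (real (S * R))\<^sup>2 + (real b)\<^sup>2 + (real (b * D))\<^sup>2 + (real S)\<^sup>2"
  have \<Theta>: "1 \<le> \<Theta>"
  proof -
    have "1 \<le> (real S)\<^sup>2" using S(1) by simp
    then show ?thesis unfolding \<Theta>_def by (simp add: add_increasing)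
  qed
  define \<delta> where "\<delta> = min \<eta> (1 / real (2 * W * R)) / (2 * \<Theta>)"
  have "0 < \<delta>"
    using \<eta>(1) W(1) R(1) \<Theta> by (simp add: \<delta>_def)
  then obtain A where A: "A \<in> sets M" "0 < measure M A" "measure M A < \<delta>"
    using aperiodic_small_sets[OF assms(1,3)] by blast
  let ?\<alpha> = "measure M A"
  have "2 * \<Theta> * ?\<alpha> \<le> 2 * \<Theta> * \<delta>"
    using A(3) \<Theta> by (intro mult_left_mono) auto
  also have "\<dots> = min \<eta> (1 / real (2 * W * R))"
    using \<Theta> by (simp add: \<delta>_def)
  finally have small: "2 * \<Theta> * ?\<alpha> \<le> \<eta>" "2 * \<Theta> * ?\<alpha> \<le> 1 / real (2 * W * R)"
    by simp_all
  have nonneg: "0 \<le> \<Theta> * ?\<alpha>"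
    using \<Theta> by simp
  interpret clocked_system M T A
    using A(1) ergodic_hits[OF assms(2) A(1,2)] by unfold_locales
  have b: "0 < b" by (simp add: b_def R)
  note pos = R(1) S(1) b D(1)
  define c' where "c' = recolour c g R S b D"
  have \<Theta>_le: "p * ?\<alpha> \<le> 2 * \<Theta> * ?\<alpha>" if "p \<le> 2 * \<Theta>" for p
    using that by (intro mult_right_mono) auto
  show thesis
  proof (rule that[of c' N J])
    show "c' \<in> measurable M (count_space UNIV)"
      unfolding c'_def by (rule recolour_measurable[OF c(1) pos])
    show "c' x \<in> {1..l}" if "x \<in> space M" for x
      using W(2) c(2)[OF that] assms(4)
      by (auto simp: c'_def recolour_def[OF c(1) pos] clock_letter_def Let_def)
    have "((real (S * R))\<^sup>2 + (real b)\<^sup>2 + (real (b * D))\<^sup>2) * ?\<alpha> \<le> 2 * \<Theta> * ?\<alpha>"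
      by (intro \<Theta>_le) (simp add: \<Theta>_def)
    then have "measure M {x \<in> space M. c' x \<noteq> c x}
        \<le> 1 / real R + 1 / real b + real R / real D + 2 * \<Theta> * ?\<alpha>"
      unfolding c'_def by (rule order_trans[OF measure_recolour_differ[OF c(1) pos] add_left_mono])
    then show "measure M {x \<in> space M. c' x \<noteq> c x} < \<epsilon>"
      using R(2) D(2) small(1) \<eta>(1,2) unfolding b_def by linarith
    show "k \<le> N" by (rule N(2))
    show "clustered M T l c' k N J"
      unfolding clustered_def
    proof (intro ballI conjI)
      fix n B assume n: "n \<in> {N..k * N}" and B: "B \<in> blocks l n"
      have len: "length B = n" using B by (simp add: blocks_def)
      obtain v where v: "v < W" "n \<le> v + 1" "\<And>j. j < n \<Longrightarrow> g (v - j) = B ! j"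
        using place[OF _ B] n by auto
      have "(real (S * R))\<^sup>2 * ?\<alpha> \<le> 2 * \<Theta> * ?\<alpha>"
        by (intro \<Theta>_le) (simp add: \<Theta>_def)
      moreover have "1 / real (W * R) = 2 * (1 / real (2 * W * R))"
        using W(1) R(1) by simp
      moreover have "1 / real (W * R) - (real (S * R))\<^sup>2 * ?\<alpha> \<le> measure M (spells M T c' B)"
        unfolding c'_def
        by (rule measure_spells_recolour_ge[where g = g, OF c(1) pos S_def W(3) v(1)])
          (use v(2,3) len in auto)
      moreover have "w \<le> m" if "p \<le> q" "u = 2 * w" "u - p \<le> m" "q \<le> w" for p q u w m :: real
        using that by linarith
      ultimately have ge: "1 / real (2 * W * R) \<le> measure M (spells M T c' B)"
        using small(2) by blast
      have "real k < real (J + 1) * (1 / real (2 * W * R))"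
        using W(1) R(1) by (simp add: J_def field_simps)
      also have "\<dots> \<le> real (J + 1) * measure M (spells M T c' B)"
        using ge by (intro mult_left_mono) auto
      finally show "real k < real (J + 1) * measure M (spells M T c' B)" .
      have "(2 * (real (S * R))\<^sup>2 + (real S)\<^sup>2) * ?\<alpha> \<le> 2 * \<Theta> * ?\<alpha>"
        by (intro \<Theta>_le) (simp add: \<Theta>_def)
      moreover have "measure M (meets M T J (spells M T c' B))
          \<le> 2 / real R + real K / real S + (2 * (real (S * R))\<^sup>2 + (real S)\<^sup>2) * ?\<alpha>"
        unfolding c'_def
      proof (rule measure_meets_recolour_le[OF c(1) pos])
        show "2 * b * D \<le> length B" "J + length B \<le> K" "K \<le> S"
          using n N(1) S(2) unfolding len K_def by auto
      qed
      ultimately have "measure M (meets M T J (spells M T c' B))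
          \<le> 2 / real R + real K / real S + 2 * \<Theta> * ?\<alpha>"
        by (meson add_left_mono order_trans)
      moreover have "2 / real R \<le> 2 * \<eta>" using R(2) by simp
      ultimately show "measure M (meets M T J (spells M T c' B)) < 1 / (real k)\<^sup>2"
        using S(3) small(1) \<eta>(1,3) by linarith
    qed
  qed
qed

end

section \<open>The residual set\<close>

text \<open>
  Up to the time \<open>k * N k\<close>, the \<open>k\<close>-th interval alone fills the proportion \<open>1 - 1 / k\<close>.
\<close>

lemma upper_density_long_intervals:
  assumes N: "\<And>k. 1 \<le> k \<Longrightarrow> k \<le> N k"
  shows "upper_density (\<Union>k\<in>{1..}. {N k..k * N k}) = 1"
proof (rule antisym)
  let ?N0 = "\<Union>k\<in>{1..}. {N k..k * N k}"
  let ?X = "\<lambda>n. ereal (real (card (?N0 \<inter> {1..n})) / real n)"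
  have "?X n \<le> 1" for n
  proof -
    have "card (?N0 \<inter> {1..n}) \<le> n"
      using card_mono[of "{1..n}" "?N0 \<inter> {1..n}"] by simp
    then show ?thesis by (cases "n = 0") (simp_all add: divide_le_eq_1)
  qed
  then show "upper_density ?N0 \<le> 1"
    unfolding upper_density_def by (intro Limsup_bounded) simp
  show "1 \<le> upper_density ?N0"
  proof (rule ccontr)
    assume "\<not> 1 \<le> upper_density ?N0"
    then have "limsup ?X < 1"
      by (simp add: upper_density_def)
    then obtain z where z: "limsup ?X < ereal z" "z < 1"
      using ereal_dense2[of "limsup ?X" 1] by (auto simp: one_ereal_def)
    then obtain m where m: "\<And>n. m \<le> n \<Longrightarrow> ?X n < ereal z"
      using Limsup_lessD[OF z(1)] by (auto simp: eventually_sequentially)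
    obtain k0 :: nat where k0: "0 < k0" "inverse (real k0) < 1 - z"
      using ex_inverse_of_nat_less[of "1 - z"] z(2) by auto
    define k where "k = max k0 m"
    have k: "1 \<le> k" "k0 \<le> k" "m \<le> k"
      using k0(1) by (simp_all add: k_def)
    let ?n = "k * N k"
    have Nk: "1 \<le> N k" using N[OF k(1)] k(1) by linarith
    have "{N k..?n} \<subseteq> ?N0 \<inter> {1..?n}"
      using k(1) Nk by auto
    then have "card {N k..?n} \<le> card (?N0 \<inter> {1..?n})"
      by (intro card_mono) auto
    then have "?n \<le> card (?N0 \<inter> {1..?n}) + N k"
      by simp
    then have "real ?n - real (N k) \<le> real (card (?N0 \<inter> {1..?n}))"
      by (metis diff_le_eq of_nat_add of_nat_le_iff)
    then have "(real ?n - real (N k)) / real ?n \<le> real (card (?N0 \<inter> {1..?n})) / real ?n"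
      by (rule divide_right_mono) simp
    moreover have "(real ?n - real (N k)) / real ?n = 1 - inverse (real k)"
      using Nk k(1) by (simp add: field_simps)
    moreover have "inverse (real k) \<le> inverse (real k0)"
      using k(2) k0(1) by (intro le_imp_inverse_le) auto
    ultimately have "z < real (card (?N0 \<inter> {1..?n})) / real ?n"
      using k0(2) by linarith
    moreover have "m \<le> ?n"
      using k(3) Nk by (metis mult.right_neutral mult_le_mono)
    ultimately show False
      using m[of ?n] by simp
  qed
qed

context mp_system
begin

definition clustering_partitions :: "nat \<Rightarrow> nat \<Rightarrow> (nat \<Rightarrow> 'a set) set set" where
  "clustering_partitions l k = {p \<in> partition_space M l.
    \<forall>P\<in>p. \<exists>N J. k \<le> N \<and> clustered M T l (cell_index l P) k N J}"

lemma openin_clustering_partitions: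
  "openin (rokhlin_topology M l) (clustering_partitions l k)"
proof -
  interpret Metric_space "partition_space M l" "rokhlin_dist M l"
    by (rule Metric_space_partition_space[OF prob_space_axioms])
  show ?thesis
    unfolding rokhlin_topology_def openin_mtopology
  proof (intro conjI allI impI)
    show "clustering_partitions l k \<subseteq> partition_space M l"
      by (auto simp: clustering_partitions_def)
  next
    fix p assume p: "p \<in> clustering_partitions l k"
    then have pM: "p \<in> partition_space M l"
      by (simp add: clustering_partitions_def)
    obtain P where P: "P \<in> p"
      using partition_space_representative[OF pM] .
    obtain N J where NJ: "k \<le> N" "clustered M T l (cell_index l P) k N J"
      using p P by (auto simp: clustering_partitions_def)
    obtain \<delta> where \<delta>: "0 < \<delta>"
      "\<And>Q. Q \<in> enum_partitions M l \<Longrightarrow> enum_dist M l P Q < \<delta> \<Longrightarrow> clustered M T l (cell_index l Q) k N J"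
      using clustered_open[OF partition_space_member[OF pM P] NJ(2)] by blast
    have "mball p \<delta> \<subseteq> clustering_partitions l k"
    proof
      fix q assume q: "q \<in> mball p \<delta>"
      then have qM: "q \<in> partition_space M l" by simp
      have "clustered M T l (cell_index l Q) k N J" if Q: "Q \<in> q" for Q
        using q rokhlin_dist_eq[OF prob_space_axioms pM P qM Q]
        by (intro \<delta>(2) partition_space_member[OF qM Q]) simp
      then show "q \<in> clustering_partitions l k"
        using qM NJ(1) by (auto simp: clustering_partitions_def)
    qed
    then show "\<exists>r>0. mball p r \<subseteq> clustering_partitions l k"
      using \<delta>(1) by blast
  qed
qed

text \<open>
  The construction gives a clustering representative of a nearby class. The other representatives are
  at distance zero from it and inherit the property from the openness lemma.
\<close>

lemma clustering_partitions_dense: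
  assumes "standard_prob_space M" "ergodic_map M T" "aperiodic_map M T" "2 \<le> l" "1 \<le> k"
  shows "rokhlin_topology M l closure_of clustering_partitions l k = partition_space M l"
proof -
  interpret Metric_space "partition_space M l" "rokhlin_dist M l"
    by (rule Metric_space_partition_space[OF prob_space_axioms])
  have "\<exists>q\<in>clustering_partitions l k. q \<in> mball p r" if pM: "p \<in> partition_space M l" and r: "0 < r" for p r
  proof -
    obtain P where P: "P \<in> p"
      using partition_space_representative[OF pM] .
    note Pe = partition_space_member[OF pM P]
    let ?c = "cell_index l P"
    have c [measurable]: "?c \<in> measurable M (count_space UNIV)"
      by (rule cell_index_measurable[OF Pe])
    have "0 < r / real l" using r assms(4) by simp
    then obtain c' N J where c' [measurable]: "c' \<in> measurable M (count_space UNIV)"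
      and c'_range: "\<And>x. x \<in> space M \<Longrightarrow> c' x \<in> {1..l}"
      and near: "measure M {x \<in> space M. c' x \<noteq> ?c x} < r / real l"
      and NJ: "k \<le> N" "clustered M T l c' k N J"
      using clustered_dense[OF assms(1-4) c cell_index(1)[OF Pe] assms(5)] by blast
    define Q where "Q = colour_partition M c'"
    have Qe: "Q \<in> enum_partitions M l"
      unfolding Q_def by (rule colour_partition_enum[OF c' c'_range])
    have same: "cell_index l Q x = c' x" if "x \<in> space M" for x
      unfolding Q_def by (rule cell_index_colour_partition[where c = c', OF that c'_range[OF that]])
    have "spells M T (cell_index l Q) B = spells M T c' B" for B
      using same funpow_space by (auto simp: spells_def)
    then have cl: "clustered M T l (cell_index l Q) k N J"
      using NJ(2) by (simp add: clustered_def)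
    define q where "q = same_partition M l `` {Q}"
    have q: "q \<in> partition_space M l" "Q \<in> q"
      unfolding q_def using partition_space_class[OF Qe] by auto
    obtain \<delta> where \<delta>: "0 < \<delta>"
      "\<And>Q'. Q' \<in> enum_partitions M l \<Longrightarrow> enum_dist M l Q Q' < \<delta> \<Longrightarrow> clustered M T l (cell_index l Q') k N J"
      using clustered_open[OF Qe cl] by blast
    have "clustered M T l (cell_index l Q') k N J" if "Q' \<in> q" for Q'
    proof (rule \<delta>(2))
      show "Q' \<in> enum_partitions M l"
        by (rule partition_space_member[OF q(1) that])
      have "rokhlin_dist M l q q = 0" using q(1) by simp
      then show "enum_dist M l Q Q' < \<delta>"
        using rokhlin_dist_eq[OF prob_space_axioms q q(1) that] \<delta>(1) by simp
    qed
    then have "q \<in> clustering_partitions l k"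
      using q(1) NJ(1) by (auto simp: clustering_partitions_def)
    moreover have "rokhlin_dist M l p q < r"
    proof -
      have "{x \<in> space M. c' x \<noteq> ?c x} \<in> sets M"
        using differ_sets[OF c' c] by (simp add: differ_def)
      then have "enum_dist M l P Q \<le> real l * measure M {x \<in> space M. c' x \<noteq> ?c x}"
        by (rule enum_dist_le_measure[OF Pe Qe]) (simp add: same)
      also have "\<dots> < r"
        using near assms(4) by (simp add: field_simps)
      finally show ?thesis
        using rokhlin_dist_eq[OF prob_space_axioms pM P q] by simp
    qed
    ultimately show ?thesis
      using pM q(1) by auto
  qed
  then show ?thesis
    unfolding rokhlin_topology_def metric_closure_of by auto
qed

lemma residual_clustering_partitions:
  assumes "standard_prob_space M" "ergodic_map M T" "aperiodic_map M T" "2 \<le> l"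
  shows "residual_in (rokhlin_topology M l) (\<Inter>k\<in>{1..}. clustering_partitions l k)"
proof -
  interpret Metric_space "partition_space M l" "rokhlin_dist M l"
    by (rule Metric_space_partition_space[OF prob_space_axioms])
  let ?\<G> = "clustering_partitions l ` {1..}"
  have top: "topspace (rokhlin_topology M l) = partition_space M l"
    by (simp add: rokhlin_topology_def)
  have "mtopology closure_of \<Inter>?\<G> = partition_space M l"
  proof (rule metric_Baire_category[OF mcomplete_partition_space])
    show "countable ?\<G>" by simp
    show "openin mtopology U \<and> mtopology closure_of U = partition_space M l" if "U \<in> ?\<G>" for U
      using that openin_clustering_partitions clustering_partitions_dense[OF assms]
      by (auto simp: rokhlin_topology_def)
  qed
  moreover have "gdelta_in (rokhlin_topology M l) (\<Inter>?\<G>)"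
    using openin_clustering_partitions by (intro gdelta_in_Inter) (auto intro: open_imp_gdelta_in)
  ultimately show ?thesis
    unfolding residual_in_def top rokhlin_topology_def[symmetric]
    using gdelta_in_subset[of "rokhlin_topology M l" "\<Inter>?\<G>"] by (auto simp: top)
qed

text \<open>
  For \<open>k\<close> with \<open>\<epsilon> \<le> k\<close> and \<open>1 / k \<le> \<epsilon>\<close>, the bound \<open>1 / k\<^sup>2\<close> for hitting times up to \<open>k\<close> is a bound by
  \<open>\<epsilon>\<^sup>2\<close> for hitting times up to \<open>\<epsilon>\<close>. Lengths beyond all the intervals with \<open>k \<le> k0\<close> belong to later
  intervals.
\<close>

lemma clustering_partition_entry_cdf:
  assumes "ae_injective M T" and P: "P \<in> enum_partitions M l"
    and cl: "\<And>k. 1 \<le> k \<Longrightarrow> \<exists>N J. k \<le> N \<and> clustered M T l (cell_index l P) k N J"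
  shows "\<exists>N0 :: nat set. upper_density N0 = 1 \<and>
    (\<forall>\<epsilon>>0. \<exists>n\<^sub>\<epsilon> :: nat. \<forall>n\<in>N0. n > n\<^sub>\<epsilon> \<longrightarrow>
      (\<forall>B\<in>blocks l n.
        measure (process_measure M T l P) (cylinder l B) > 0 \<longrightarrow>
        entry_cdf (process_measure M T l P) l B \<epsilon> < \<epsilon>\<^sup>2))"
proof -
  obtain N J where N: "\<And>k. 1 \<le> k \<Longrightarrow> k \<le> N k"
    and NJ: "\<And>k. 1 \<le> k \<Longrightarrow> clustered M T l (cell_index l P) k (N k) (J k)"
    using cl by metis
  let ?N0 = "\<Union>k\<in>{1..}. {N k..k * N k}"
  have "\<exists>n\<^sub>\<epsilon>. \<forall>n\<in>?N0. n > n\<^sub>\<epsilon> \<longrightarrow> (\<forall>B\<in>blocks l n.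
        measure (process_measure M T l P) (cylinder l B) > 0 \<longrightarrow>
        entry_cdf (process_measure M T l P) l B \<epsilon> < \<epsilon>\<^sup>2)" if \<epsilon>: "0 < \<epsilon>" for \<epsilon> :: real
  proof -
    obtain k0 :: nat where k0: "max \<epsilon> (1 / \<epsilon>) \<le> real k0"
      using real_arch_simple by blast
    show ?thesis
    proof (intro exI ballI impI)
      fix n B
      assume n: "n \<in> ?N0" "n > (\<Sum>k\<le>k0. k * N k)" and B: "B \<in> blocks l n"
        and pos: "measure (process_measure M T l P) (cylinder l B) > 0"
      obtain k where k: "1 \<le> k" "n \<in> {N k..k * N k}"
        using n(1) by auto
      have "k0 < k"
      proof (rule ccontr)
        assume "\<not> k0 < k"
        then have "k * N k \<le> (\<Sum>k\<le>k0. k * N k)"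
          by (intro member_le_sum) auto
        then show False using n(2) k(2) by simp
      qed
      then have k\<epsilon>: "\<epsilon> \<le> real k" "1 / \<epsilon> \<le> real k"
        using k0 by linarith+
      let ?C = "spells M T (cell_index l P) B"
      have *: "real k < real (J k + 1) * measure M ?C" "measure M (meets M T (J k) ?C) < 1 / (real k)\<^sup>2"
        using NJ[OF k(1)] k(2) B unfolding clustered_def by blast+
      have "\<epsilon> < real (J k + 1) * measure M ?C"
        using *(1) k\<epsilon>(1) by linarith
      then have "entry_cdf (process_measure M T l P) l B \<epsilon> \<le> measure M (meets M T (J k) ?C)"
        by (rule entry_cdf_le_measure_meets[OF assms(1) P pos])
      also have "\<dots> < 1 / (real k)\<^sup>2" by (rule *(2))
      also have "\<dots> \<le> \<epsilon>\<^sup>2"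
      proof -
        have "1 / real k \<le> \<epsilon>"
          using k\<epsilon>(2) k(1) \<epsilon> by (simp add: field_simps)
        then have "(1 / real k)\<^sup>2 \<le> \<epsilon>\<^sup>2"
          by (rule power_mono) simp
        then show ?thesis by (simp add: power_divide)
      qed
      finally show "entry_cdf (process_measure M T l P) l B \<epsilon> < \<epsilon>\<^sup>2" .
    qed
  qed
  then show ?thesis
    using upper_density_long_intervals[of N, OF N] by blast
qed

end

theorem theorem1:
  fixes M :: "'a measure" and T :: "'a \<Rightarrow> 'a" and l :: nat
  assumes "standard_prob_space M"
    and "measure_preserving_map M T"
    and "ae_injective M T"
    and "ergodic_map M T"
    and "aperiodic_map M T"
    and "2 \<le> l"
  shows "\<exists>C. residual_in (rokhlin_topology M l) C \<and>
    (\<forall>p\<in>C. \<forall>P\<in>p.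
      \<exists>N0 :: nat set. upper_density N0 = 1 \<and>
        (\<forall>\<epsilon>>0. \<exists>n\<^sub>\<epsilon> :: nat. \<forall>n\<in>N0. n > n\<^sub>\<epsilon> \<longrightarrow>
          (\<forall>B\<in>blocks l n.
            measure (process_measure M T l P) (cylinder l B) > 0 \<longrightarrow>
            entry_cdf (process_measure M T l P) l B \<epsilon> < \<epsilon>\<^sup>2)))"
proof -
  have "prob_space M"
    using assms(1) by (simp add: standard_prob_space_def)
  then interpret mp_system M T
    using assms(2) by (simp add: mp_system_def mp_system_axioms_def measure_preserving_map_def)
  let ?C = "\<Inter>k\<in>{1..}. clustering_partitions l k"
  show ?thesis
  proof (intro exI[of _ ?C] conjI ballI)
    show "residual_in (rokhlin_topology M l) ?C"
      by (rule residual_clustering_partitions[OF assms(1,4,5,6)])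
  next
    fix p P assume p: "p \<in> ?C" and P: "P \<in> p"
    have k: "p \<in> clustering_partitions l k" if "1 \<le> k" for k
      using p that by blast
    have "p \<in> partition_space M l"
      using k[of 1] by (simp add: clustering_partitions_def)
    then have "P \<in> enum_partitions M l"
      using P by (rule partition_space_member)
    then show "\<exists>N0 :: nat set. upper_density N0 = 1 \<and>
        (\<forall>\<epsilon>>0. \<exists>n\<^sub>\<epsilon> :: nat. \<forall>n\<in>N0. n > n\<^sub>\<epsilon> \<longrightarrow>
          (\<forall>B\<in>blocks l n.
            measure (process_measure M T l P) (cylinder l B) > 0 \<longrightarrow>
            entry_cdf (process_measure M T l P) l B \<epsilon> < \<epsilon>\<^sup>2))"
    proof (rule clustering_partition_entry_cdf[OF assms(3)])
      show "\<exists>N J. k \<le> N \<and> clustered M T l (cell_index l P) k N J" if "1 \<le> k" for k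
        using k[OF that] P by (auto simp: clustering_partitions_def)
    qed
  qed
qed

end
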